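(* Suppose $g$ is convex ($f$ need not be convex), and let $\{x_k\},\{v_k\}$ be generated by the niAPG algorithm with inexact proximal steps whose duality gaps $\varepsilon_k$ satisfy $\varepsilon_k=O(1/k^{1+\varsigma})$ for some $\varsigma>0$. Let $c=\sum_{k=1}^\infty\varepsilon_k$ (so $c<\infty$), $\phi(k)=\arg\min_{t=\max(k-q,1),\dots,k}\|x_{t+1}-v_t\|_2^2$, and $c_1=\max_{t=1,\dots,q+1}F(x_t)-\inf F$. Then (i) $\lim_{k\to\infty}\|\mathcal{G}(v_{\phi(k)})\|_2^2=0$; and (ii) for every $K\ge1$, $\displaystyle\min_{k=1,\dots,K}\|\mathcal{G}(v_{\phi(k)})\|_2^2\le\frac{2}{K}\left(4c+\frac{(q+1)(c_1+\rho c)}{\rho-L}\right)$.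
   Context: Setting: $F=f+g$ on $\mathbb{R}^d$, where $f:\mathbb{R}^d\to\mathbb{R}$ is differentiable and $L$-Lipschitz smooth ($\|\nabla f(x)-\nabla f(y)\|_2\le L\|x-y\|_2$ for all $x,y$), $g:\mathbb{R}^d\to(-\infty,+\infty]$ is proper and lower semicontinuous, $F$ is bounded from below, and $F(x)\to\infty$ as $\|x\|_2\to\infty$. The (exact) proximal step is $\mathrm{prox}_{\eta g}(z)=\arg\min_x \frac12\|x-z\|_2^2+\eta g(x)$, and the proximal mapping is $\mathcal{G}(v)=v-\mathrm{prox}_{\eta g}(v-\eta\nabla f(v))$. niAPG algorithm: choose $\eta\in(0,1/L)$, $\delta\in(0,\frac1\eta-L)$, and an integer $q\ge 0$; put $\rho=1/\eta$ and $x_0=x_1=0$. For $k=1,2,\dots$: $y_k=x_k+\frac{k-1}{k+2}(x_k-x_{k-1})$; $\Delta_k=\max_{t=\max(1,k-q),\dots,k}F(x_t)$; $v_k=y_k$ if $F(y_k)\le\Delta_k$, and $v_k=x_k$ otherwise; $z_k=v_k-\eta\nabla f(v_k)$; $x_{k+1}=\mathrm{prox}_{\eta g}(z_k)$ (possibly computed inexactly). Inexact proximal step for convex $g$: let $h_{\eta g}(x)=\frac12\|x-z_k\|_2^2+\eta g(x)$ and let $\mathcal{D}_{\eta g}(w)=\eta\left(z_k^\top w-g^*(w)\right)-\frac{\eta^2}{2}\|w\|_2^2$ be the dual objective, where $g^*$ is the convex conjugate of $g$. An approximate dual maximizer $\tilde w_k$ is computed, one sets $x_{k+1}=z_k-\eta\tilde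 w_k$, and the duality gap is $\varepsilon_k=h_{\eta g}(x_{k+1})-\mathcal{D}_{\eta g}(\tilde w_k)$. *)

theory Defs
  imports "HOL-Analysis.Analysis" "HOL-Library.Landau_Symbols"
begin

section \<open>Extended-real-valued functions\<close>

definition proper_fun :: "('a \<Rightarrow> ereal) \<Rightarrow> bool" where
  "proper_fun g \<longleftrightarrow> (\<forall>x. g x \<noteq> -\<infinity>) \<and> (\<exists>x. g x \<noteq> \<infinity>)"

definition lsc_fun :: "('a::topological_space \<Rightarrow> ereal) \<Rightarrow> bool" where
  "lsc_fun g \<longleftrightarrow> (\<forall>x. g x \<le> Liminf (at x) g)"

text \<open>The library's \<open>convex_on\<close> is restricted to real-valued functions. The weights \<open>0\<close> and \<open>1\<close>
  are harmless here because \<open>0 * \<infinity> = 0\<close> in \<^typ>\<open>ereal\<close>.\<close>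

definition convex_fun :: "('a::real_vector \<Rightarrow> ereal) \<Rightarrow> bool" where
  "convex_fun g \<longleftrightarrow>
    (\<forall>x y. \<forall>u\<ge>0. \<forall>v\<ge>0. u + v = 1 \<longrightarrow>
      g (u *\<^sub>R x + v *\<^sub>R y) \<le> ereal u * g x + ereal v * g y)"

definition convex_conjugate :: "('a::real_inner \<Rightarrow> ereal) \<Rightarrow> 'a \<Rightarrow> ereal" where
  "convex_conjugate g w = (SUP x. ereal (w \<bullet> x) - g x)"

definition gradient :: "('a::real_inner \<Rightarrow> real) \<Rightarrow> 'a \<Rightarrow> 'a" where
  "gradient f x = (THE D. GDERIV f x :> D)"

definition objective :: "('a \<Rightarrow> real) \<Rightarrow> ('a \<Rightarrow> ereal) \<Rightarrow> 'a \<Rightarrow> ereal" where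
  "objective f g x = ereal (f x) + g x"

section \<open>Proximal step\<close>

definition prox_objective :: "real \<Rightarrow> ('a::real_inner \<Rightarrow> ereal) \<Rightarrow> 'a \<Rightarrow> 'a \<Rightarrow> ereal" where
  "prox_objective \<eta> g z x = ereal (1 / 2 * (norm (x - z))\<^sup>2) + ereal \<eta> * g x"

definition prox :: "real \<Rightarrow> ('a::real_inner \<Rightarrow> ereal) \<Rightarrow> 'a \<Rightarrow> 'a" where
  "prox \<eta> g z = arg_min (prox_objective \<eta> g z) (\<lambda>x. True)"

definition forward_step :: "real \<Rightarrow> ('a::real_inner \<Rightarrow> real) \<Rightarrow> 'a \<Rightarrow> 'a" where
  "forward_step \<eta> f v = v - \<eta> *\<^sub>R gradient f v"

definition prox_mapping ::
    "real \<Rightarrow> ('a::real_inner \<Rightarrow> real) \<Rightarrow> ('a \<Rightarrow> ereal) \<Rightarrow> 'a \<Rightarrow> 'a" where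
  "prox_mapping \<eta> f g v = v - prox \<eta> g (forward_step \<eta> f v)"

definition dual_objective :: "real \<Rightarrow> ('a::real_inner \<Rightarrow> ereal) \<Rightarrow> 'a \<Rightarrow> 'a \<Rightarrow> ereal" where
  "dual_objective \<eta> g z w =
    ereal \<eta> * (ereal (z \<bullet> w) - convex_conjugate g w) - ereal (\<eta>\<^sup>2 / 2 * (norm w)\<^sup>2)"

section \<open>The niAPG iteration with inexact proximal steps\<close>

text \<open>\<open>{t. max(1, k - q) \<le> t \<le> k}\<close>; truncated subtraction does not matter because of the maximum with 1.\<close>

definition window :: "nat \<Rightarrow> nat \<Rightarrow> nat set" where
  "window q k = {max 1 (k - q)..k}"

definition extrapolation :: "(nat \<Rightarrow> 'a::real_vector) \<Rightarrow> nat \<Rightarrow> 'a" where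
  "extrapolation x k = x k + ((real k - 1) / (real k + 2)) *\<^sub>R (x k - x (k - 1))"

definition reference_value :: "('a \<Rightarrow> ereal) \<Rightarrow> nat \<Rightarrow> (nat \<Rightarrow> 'a) \<Rightarrow> nat \<Rightarrow> ereal" where
  "reference_value F q x k = Max ((\<lambda>t. F (x t)) ` window q k)"

text \<open>\<open>w k\<close> is the approximate dual maximizer of step \<open>k\<close> and \<open>\<epsilon> k\<close> its duality gap; \<open>\<epsilon>\<close> being
  real-valued expresses that all gaps are finite. Nothing is assumed about \<open>v\<close>, \<open>w\<close>, \<open>\<epsilon>\<close> at
  index \<open>0\<close>, where the iteration does not define them.\<close>

definition niAPG_inexact ::
    "('a::real_inner \<Rightarrow> real) \<Rightarrow> ('a \<Rightarrow> ereal) \<Rightarrow> real \<Rightarrow> nat \<Rightarrow>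
      (nat \<Rightarrow> 'a) \<Rightarrow> (nat \<Rightarrow> 'a) \<Rightarrow> (nat \<Rightarrow> 'a) \<Rightarrow> (nat \<Rightarrow> real) \<Rightarrow> bool" where
  "niAPG_inexact f g \<eta> q x v w \<epsilon> \<longleftrightarrow>
    x 0 = 0 \<and> x 1 = 0 \<and>
    (\<forall>k\<ge>1.
      v k = (if objective f g (extrapolation x k) \<le> reference_value (objective f g) q x k
             then extrapolation x k else x k) \<and>
      x (k + 1) = forward_step \<eta> f (v k) - \<eta> *\<^sub>R w k \<and>
      ereal (\<epsilon> k) = prox_objective \<eta> g (forward_step \<eta> f (v k)) (x (k + 1))
                    - dual_objective \<eta> g (forward_step \<eta> f (v k)) (w k))"

end

theory Submission
  imports Defs
begin

text \<open>
  Because \<open>x\<^sub>k\<^sub>+\<^sub>1 = z\<^sub>k - \<eta> w\<^sub>k\<close>, the duality gap is \<open>\<eta>\<close> times the Fenchel--Young gap of \<open>g\<close> at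
  \<open>(x\<^sub>k\<^sub>+\<^sub>1, w\<^sub>k)\<close>, so \<open>w\<^sub>k\<close> is a \<open>\<rho> \<epsilon>\<^sub>k\<close>-subgradient of \<open>g\<close> at \<open>x\<^sub>k\<^sub>+\<^sub>1\<close>. With the exact proximal point \<open>p\<^sub>k\<close>,
  \<open>e = x\<^sub>k\<^sub>+\<^sub>1 - p\<^sub>k\<close> and \<open>a\<^sub>k = \<parallel>x\<^sub>k\<^sub>+\<^sub>1 - v\<^sub>k\<parallel>\<^sup>2\<close> this yields \<open>\<parallel>e\<parallel>\<^sup>2 \<le> \<epsilon>\<^sub>k\<close> and the descent
  \<open>F x\<^sub>k\<^sub>+\<^sub>1 \<le> \<Delta>\<^sub>k - (\<rho> - L/2) a\<^sub>k + \<rho> \<tau>\<^sub>k\<close>, where \<open>\<tau>\<^sub>k \<le> \<epsilon>\<^sub>k\<close> is the part of the error that can really raise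
  \<open>F\<close>; what is left of it controls the defect of the step, since
  \<open>\<parallel>v\<^sub>k - p\<^sub>k\<parallel>\<^sup>2 \<le> s a\<^sub>k + s' (\<epsilon>\<^sub>k - \<tau>\<^sub>k)\<close> for conjugate exponents \<open>s \<le> 2 \<le> s'\<close>.
  Over a full window of length \<open>q + 1\<close> the reference value \<open>\<Delta>\<close> drops by the smallest \<open>a\<^sub>k\<close>, up to the errors
  \<open>\<tau>\<^sub>k\<close>; this gives the limit.

  For the rate one writes \<open>K = n (q + 1) + r\<close> with \<open>r \<le> q\<close>, so that the last \<open>n (q + 1)\<close> indices split into full
  windows. The first \<open>r\<close> indices need not lower \<open>\<Delta>\<close> at all. There \<open>F\<close> plus the kinetic energy
  \<open>\<rho>/2 \<parallel>x\<^sub>k - x\<^sub>k\<^sub>-\<^sub>1\<parallel>\<^sup>2\<close> decreases instead, as long as the momentum factor is at most about \<open>1 - L/(2\<rho>)\<close>, which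
  bounds \<open>r\<close> times the smallest \<open>a\<^sub>k\<close>. The term \<open>4 c\<close> of the bound and a good choice of \<open>s\<close> absorb this contribution.
\<close>

section \<open>Inexact proximal steps\<close>

text \<open>The Riesz representative of the derivative is \<open>adjoint f' 1\<close>; its
  uniqueness makes the definite description in \<open>gradient\<close> denote it.\<close>

lemma gderiv_gradient:
  fixes f :: "'a::euclidean_space \<Rightarrow> real"
  assumes "f differentiable (at u)"
  shows "GDERIV f u :> gradient f u"
proof -
  obtain f' where f': "(f has_derivative f') (at u)"
    using assms by (auto simp: differentiable_def)
  then have lin: "linear f'"
    by (rule has_derivative_linear)
  have "f' h = h \<bullet> adjoint f' 1" for h
    using adjoint_works[OF lin, of h 1] by simp
  then have "f' = (\<lambda>h. h \<bullet> adjoint f' 1)"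
    by auto
  with f' have G: "GDERIV f u :> adjoint f' 1"
    by (simp add: gderiv_def)
  have uniq: "D = adjoint f' 1" if "GDERIV f u :> D" for D
  proof -
    have "(\<lambda>h. h \<bullet> D) = (\<lambda>h. h \<bullet> adjoint f' 1)"
      using that G unfolding gderiv_def by (rule has_derivative_unique)
    then show ?thesis
      using vector_eq_ldot[of D "adjoint f' 1"] by (simp add: fun_eq_iff)
  qed
  show ?thesis
    unfolding gradient_def using G uniq by (rule theI)
qed

text \<open>On the ray from \<open>x\<close> through \<open>y\<close>, \<open>\<psi>\<close> is
  \<open>f\<close> minus the first- and second-order terms of the bound. Cauchy-Schwarz and the
  Lipschitz condition make its derivative nonpositive for nonnegative \<open>t\<close>, so comparing
  \<open>t = 0\<close> with \<open>t = 1\<close> suffices and no integral occurs.\<close>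

lemma lipschitz_gradient_upper_bound:
  fixes f :: "'a::euclidean_space \<Rightarrow> real"
  assumes diff: "\<And>u. f differentiable (at u)" and lip: "L-lipschitz_on UNIV (gradient f)"
  shows "f y \<le> f x + gradient f x \<bullet> (y - x) + L / 2 * (norm (y - x))\<^sup>2"
proof -
  define d where "d = y - x"
  define \<psi> where "\<psi> t = f (x + t *\<^sub>R d) - t * (gradient f x \<bullet> d) - L / 2 * t\<^sup>2 * (norm d)\<^sup>2" for t :: real
  have fd: "(f has_derivative (\<lambda>h. h \<bullet> gradient f u)) (at u)" for u
    using gderiv_gradient[OF diff, of u] by (simp add: gderiv_def)
  have "((\<lambda>t. f (x + t *\<^sub>R d)) has_derivative (\<lambda>s. (s *\<^sub>R d) \<bullet> gradient f (x + t *\<^sub>R d))) (at t)" for t :: real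
    by (rule has_derivative_compose[of "\<lambda>t. x + t *\<^sub>R d" "\<lambda>s. s *\<^sub>R d", OF _ fd])
       (auto intro!: derivative_eq_intros)
  then have fl: "((\<lambda>t. f (x + t *\<^sub>R d)) has_real_derivative gradient f (x + t *\<^sub>R d) \<bullet> d) (at t)" for t :: real
    unfolding has_field_derivative_def
    by (rule has_derivative_eq_rhs) (auto simp: inner_commute)
  have der: "(\<psi> has_real_derivative
      gradient f (x + t *\<^sub>R d) \<bullet> d - gradient f x \<bullet> d - L * t * (norm d)\<^sup>2) (at t)" for t
    unfolding \<psi>_def by (rule derivative_eq_intros fl refl | simp)+
  have nonpos: "gradient f (x + t *\<^sub>R d) \<bullet> d - gradient f x \<bullet> d - L * t * (norm d)\<^sup>2 \<le> 0" if "0 \<le> t" for t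
  proof -
    have "(gradient f (x + t *\<^sub>R d) - gradient f x) \<bullet> d
        \<le> norm (gradient f (x + t *\<^sub>R d) - gradient f x) * norm d"
      by (rule norm_cauchy_schwarz)
    also have "norm (gradient f (x + t *\<^sub>R d) - gradient f x) \<le> L * (t * norm d)"
      using lipschitz_onD[OF lip, of "x + t *\<^sub>R d" x] that by (simp add: dist_norm)
    finally show ?thesis
      by (simp add: inner_diff_left power2_eq_square mult_right_mono algebra_simps)
  qed
  have "\<psi> 1 \<le> \<psi> 0"
  proof (rule DERIV_nonpos_imp_nonincreasing[where f = \<psi>])
    show "\<exists>y. (\<psi> has_real_derivative y) (at t) \<and> y \<le> 0" if "0 \<le> t" for t
      using der[of t] nonpos[OF that] by blast
  qed simp
  then show ?thesis
    by (simp add: \<psi>_def d_def)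
qed

lemma lipschitz_gradient_lower_bound:
  fixes f :: "'a::euclidean_space \<Rightarrow> real"
  assumes diff: "\<And>u. f differentiable (at u)" and lip: "L-lipschitz_on UNIV (gradient f)"
  shows "f x + gradient f x \<bullet> (y - x) - L / 2 * (norm (y - x))\<^sup>2 \<le> f y"
proof -
  have neg: "gradient (\<lambda>u. - f u) u = - gradient f u" for u
  proof -
    have "GDERIV (\<lambda>u. - f u) u :> - gradient f u"
      using gderiv_gradient[OF diff, of u] by (rule GDERIV_minus)
    moreover have "GDERIV (\<lambda>u. - f u) u :> gradient (\<lambda>u. - f u) u"
      using diff by (intro gderiv_gradient) simp
    ultimately have "(\<lambda>h. h \<bullet> gradient (\<lambda>u. - f u) u) = (\<lambda>h. h \<bullet> - gradient f u)"
      unfolding gderiv_def by (metis has_derivative_unique)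
    then show ?thesis
      using vector_eq_ldot[of "gradient (\<lambda>u. - f u) u" "- gradient f u"] by (simp only: fun_eq_iff)
  qed
  have "- f y \<le> - f x + gradient (\<lambda>u. - f u) x \<bullet> (y - x) + L / 2 * (norm (y - x))\<^sup>2"
    using diff lip by (intro lipschitz_gradient_upper_bound) (auto simp: neg lipschitz_on_def dist_norm norm_minus_commute)
  then show ?thesis
    by (simp add: neg)
qed

section \<open>Approximate subgradients from the duality gap, and the exact proximal point\<close>

lemma dual_gap_subgradient:
  fixes g :: "'a::real_inner \<Rightarrow> ereal"
  assumes "proper_fun g" "0 < \<eta>" "xp = z - \<eta> *\<^sub>R w"
    and gap: "ereal e = prox_objective \<eta> g z xp - dual_objective \<eta> g z w"
  shows "\<bar>g xp\<bar> \<noteq> \<infinity>"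
    and "g u = ereal r \<Longrightarrow> real_of_ereal (g xp) + w \<bullet> (u - xp) - e / \<eta> \<le> r"
proof -
  have notminf: "g xp \<noteq> -\<infinity>"
    using assms(1) by (simp add: proper_fun_def)
  show fin: "\<bar>g xp\<bar> \<noteq> \<infinity>"
  proof
    assume "\<bar>g xp\<bar> = \<infinity>"
    with notminf have "g xp = \<infinity>" by auto
    \<comment> \<open>In \<open>ereal\<close>, infinity minus anything is infinity, so a real-valued
      gap rules this case out.\<close>
    with gap \<open>0 < \<eta>\<close> show False by (simp add: prox_objective_def)
  qed
  then obtain gx where gx: "g xp = ereal gx" by auto
  obtain s where s: "convex_conjugate g w = ereal s"
    using gap \<open>0 < \<eta>\<close> by (cases "convex_conjugate g w") (auto simp: prox_objective_def dual_objective_def gx)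
  have e: "e = (norm (xp - z))\<^sup>2 / 2 + \<eta> * gx - (\<eta> * (z \<bullet> w - s) - \<eta>\<^sup>2 / 2 * (norm w)\<^sup>2)"
    using gap by (simp add: prox_objective_def dual_objective_def gx s)
  have "(norm (xp - z))\<^sup>2 = \<eta>\<^sup>2 * (w \<bullet> w)"
    by (simp add: assms(3) power_mult_distrib flip: power2_norm_eq_inner)
  moreover have "xp \<bullet> w = z \<bullet> w - \<eta> * (w \<bullet> w)"
    by (simp add: assms(3) inner_diff_left)
  ultimately have "e = \<eta> * (gx + s - xp \<bullet> w)"
    unfolding e by (simp add: inner_commute power2_eq_square right_diff_distrib distrib_left dot_square_norm)
  then have e': "e / \<eta> = gx + s - xp \<bullet> w"
    using \<open>0 < \<eta>\<close> by simp
  show "real_of_ereal (g xp) + w \<bullet> (u - xp) - e / \<eta> \<le> r" if "g u = ereal r"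
  proof -
    have "ereal (w \<bullet> u) - g u \<le> ereal s"
      using s unfolding convex_conjugate_def by (metis SUP_upper UNIV_I)
    then show ?thesis
      using e' by (simp add: that gx inner_diff_right inner_commute)
  qed
qed

text \<open>\<open>prox\<close> is a choice made by \<open>arg_min\<close>, so its minimality rests
  on the existence of some minimizer. The affine minorant, later supplied by the approximate
  subgradient \<open>w\<close>, makes minimizing sequences bounded; lower semicontinuity then passes
  to the limit of a subsequence.\<close>

lemma prox_minimizes:
  fixes g :: "'a::euclidean_space \<Rightarrow> ereal"
  assumes "proper_fun g" and lsc: "lsc_fun g" and "0 < \<eta>"
    and minor: "\<And>u r. g u = ereal r \<Longrightarrow> w \<bullet> u - s \<le> r"
  shows "prox_objective \<eta> g z (prox \<eta> g z) \<le> prox_objective \<eta> g z u"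
proof -
  define h where "h = prox_objective \<eta> g z"
  define D where "D = {u. g u \<noteq> \<infinity>}"
  define H where "H u = (norm (u - z))\<^sup>2 / 2 + \<eta> * real_of_ereal (g u)" for u
  have nm: "g u \<noteq> -\<infinity>" for u
    using assms(1) by (simp add: proper_fun_def)
  have gD: "g u = ereal (real_of_ereal (g u))" if "u \<in> D" for u
    using that nm[of u] by (cases "g u") (auto simp: D_def)
  have hD: "h u = ereal (H u)" if "u \<in> D" for u
    unfolding h_def prox_objective_def H_def by (subst gD[OF that]) simp
  have hnD: "h u = \<infinity>" if "u \<notin> D" for u
    using that \<open>0 < \<eta>\<close> by (simp add: D_def h_def prox_objective_def)
  obtain u0 where u0: "u0 \<in> D"
    using assms(1) by (auto simp: proper_fun_def D_def)
  text \<open>Completing the square in the affine minorant of \<open>g\<close> makes the sublevel sets of \<open>H\<close> bounded.\<close>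
  define c where "c = z - \<eta> *\<^sub>R w"
  define b where "b = \<eta> * (w \<bullet> z) - \<eta>\<^sup>2 / 2 * (norm w)\<^sup>2 - \<eta> * s"
  have low: "(norm (u - c))\<^sup>2 / 2 + b \<le> H u" if "u \<in> D" for u
  proof -
    have "\<eta> * (w \<bullet> u - s) \<le> \<eta> * real_of_ereal (g u)"
      using minor[OF gD[OF that]] \<open>0 < \<eta>\<close> by simp
    moreover have "(norm (u - c))\<^sup>2 = (norm (u - z))\<^sup>2 + 2 * \<eta> * (w \<bullet> u) - 2 * \<eta> * (w \<bullet> z) + \<eta>\<^sup>2 * (norm w)\<^sup>2"
      unfolding c_def power2_norm_eq_inner
      by (simp add: inner_diff_left inner_diff_right inner_commute power2_eq_square algebra_simps)
    ultimately show ?thesis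
      unfolding H_def b_def by (simp add: algebra_simps)
  qed
  have bdd: "bdd_below (H ` D)"
    by (rule bdd_belowI[of _ b]) (use low in \<open>force intro: order_trans[rotated]\<close>)
  define I where "I = Inf (H ` D)"
  have "\<exists>u\<in>D. H u < I + 1 / real (Suc k)" for k
    using cInf_lessD[of "H ` D" "I + 1 / real (Suc k)"] u0 by (auto simp: I_def)
  then obtain y where yD: "\<And>k. y k \<in> D" and yI: "\<And>k. H (y k) < I + 1 / real (Suc k)"
    by metis
  have IH: "I \<le> H u" if "u \<in> D" for u
    unfolding I_def using bdd that by (intro cInf_lower) auto
  have lim: "(\<lambda>k. H (y k)) \<longlonglongrightarrow> I"
  proof (rule tendsto_sandwich[of "\<lambda>_. I" _ _ "\<lambda>k. I + 1 / real (Suc k)"])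
    show "(\<lambda>k. I + 1 / real (Suc k)) \<longlonglongrightarrow> I"
      using tendsto_add[OF tendsto_const[of I] LIMSEQ_inverse_real_of_nat] by (simp add: inverse_eq_divide)
    show "\<forall>\<^sub>F k in sequentially. I \<le> H (y k)"
      using IH yD by simp
    show "\<forall>\<^sub>F k in sequentially. H (y k) \<le> I + 1 / real (Suc k)"
      by (rule always_eventually) (use yI less_imp_le in blast)
  qed simp
  have "bounded (range y)"
  proof -
    have "norm (y k - c) \<le> 2 * (I + 1 - b) + 1" for k
    proof -
      have "I + 1 / real (Suc k) \<le> I + 1" by simp
      then have "H (y k) \<le> I + 1"
        using yI[of k] by linarith
      then have "(norm (y k - c))\<^sup>2 \<le> 2 * (I + 1 - b)"
        using low[OF yD[of k]] by argo
      moreover have "2 * norm (y k - c) \<le> (norm (y k - c))\<^sup>2 + 1"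
        using sum_squares_bound[of "norm (y k - c)" 1] by (simp add: power2_eq_square)
      ultimately show ?thesis
        using norm_ge_zero[of "y k - c"] zero_le_power2[of "norm (y k - c)"] by linarith
    qed
    then have "y k \<in> cball c (2 * (I + 1 - b) + 1)" for k
      by (simp add: dist_norm norm_minus_commute)
    then show ?thesis
      by (meson bounded_cball bounded_subset image_subsetI)
  qed
  then obtain p and \<sigma> :: "nat \<Rightarrow> nat" where "strict_mono \<sigma>" and yp: "(\<lambda>k. y (\<sigma> k)) \<longlonglongrightarrow> p"
    using bounded_imp_convergent_subsequence[of y] by (auto simp: o_def)
  \<comment> \<open>The value \<open>G\<close> is forced: \<open>H\<close> tends to \<open>I\<close>
    and its quadratic part is continuous, so \<open>g\<close> along the subsequence tends to
    \<open>G\<close>.\<close>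
  define G where "G = (I - (norm (p - z))\<^sup>2 / 2) / \<eta>"
  have "(\<lambda>k. H (y (\<sigma> k))) \<longlonglongrightarrow> I"
    using LIMSEQ_subseq_LIMSEQ[OF lim \<open>strict_mono \<sigma>\<close>] by (simp add: o_def)
  then have "(\<lambda>k. (H (y (\<sigma> k)) - (norm (y (\<sigma> k) - z))\<^sup>2 / 2) / \<eta>) \<longlonglongrightarrow> G"
    unfolding G_def using \<open>0 < \<eta>\<close> yp by (intro tendsto_intros) auto
  then have gl: "(\<lambda>k. real_of_ereal (g (y (\<sigma> k)))) \<longlonglongrightarrow> G"
    using \<open>0 < \<eta>\<close> by (simp add: H_def)
  have gp: "g p \<le> ereal G"
  proof (rule ccontr)
    assume "\<not> g p \<le> ereal G"
    then have "ereal G < g p" by simp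
    then obtain r where r: "G < r" "ereal r < g p"
      using ereal_dense2[of "ereal G" "g p"] less_ereal.simps(1) by blast
    then have "ereal r < Liminf (at p) g"
      using lsc by (metis lsc_fun_def less_le_trans)
    then have "\<forall>\<^sub>F u in at p. ereal r < g u"
      by (rule less_LiminfD)
    \<comment> \<open>The punctured limit inferior says nothing about \<open>p\<close> itself, which
      the subsequence may hit; \<open>r(2)\<close> adds this point.\<close>
    then have "\<forall>\<^sub>F u in nhds p. ereal r < g u"
      using r(2) by (simp add: eventually_nhds_conv_at)
    then have ev: "\<forall>\<^sub>F k in sequentially. ereal r < g (y (\<sigma> k))"
      using yp by (rule eventually_compose_filterlim)
    have "\<forall>\<^sub>F k in sequentially. r \<le> real_of_ereal (g (y (\<sigma> k)))"
      using ev
    proof eventually_elim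
      case (elim k)
      then show ?case
        using gD[OF yD[of "\<sigma> k"]] by (metis ereal_less_eq(3) less_imp_le)
    qed
    then have "r \<le> G"
      using gl by (intro tendsto_lowerbound[OF gl]) auto
    with r(1) show False by simp
  qed
  then have pD: "p \<in> D" by (auto simp: D_def)
  have "H p \<le> I"
  proof -
    have "real_of_ereal (g p) \<le> G"
      using gp gD[OF pD] by (metis ereal_less_eq(3))
    then have "\<eta> * real_of_ereal (g p) \<le> \<eta> * G"
      using \<open>0 < \<eta>\<close> by simp
    then show ?thesis
      using \<open>0 < \<eta>\<close> by (simp add: H_def G_def)
  qed
  then have "h p \<le> h u" for u
    using IH[of u] hD[OF pD] hD[of u] hnD[of u] by (cases "u \<in> D") auto
  then have "is_arg_min h (\<lambda>_. True) p"
    by (simp add: is_arg_min_linorder)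
  then have "is_arg_min h (\<lambda>_. True) (prox \<eta> g z)"
    unfolding prox_def arg_min_def h_def[symmetric] by (rule someI)
  then show ?thesis
    by (simp add: is_arg_min_linorder h_def)
qed

text \<open>First-order optimality: \<open>p\<close> is compared with the points of the segment to
  \<open>u\<close>. Convexity bounds \<open>g\<close> linearly there, while the square leaves a term
  of order \<open>t\<^sup>2\<close> that vanishes after division by \<open>t\<close> as
  \<open>t\<close> tends to 0.\<close>

lemma prox_subgradient:
  fixes g :: "'a::real_inner \<Rightarrow> ereal"
  assumes "proper_fun g" "convex_fun g" "0 < \<eta>"
    and min: "\<And>u. prox_objective \<eta> g z p \<le> prox_objective \<eta> g z u"
  shows "\<bar>g p\<bar> \<noteq> \<infinity>"
    and "g u = ereal r \<Longrightarrow> real_of_ereal (g p) + (z - p) \<bullet> (u - p) / \<eta> \<le> r"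
proof -
  have nm: "g u \<noteq> -\<infinity>" for u
    using assms(1) by (simp add: proper_fun_def)
  obtain u0 r0 where u0: "g u0 = ereal r0"
    using assms(1) by (metis proper_fun_def ereal_cases)
  have "g p \<noteq> \<infinity>"
    using min[of u0] \<open>0 < \<eta>\<close> by (auto simp: prox_objective_def u0)
  with nm[of p] show fin: "\<bar>g p\<bar> \<noteq> \<infinity>" by auto
  then obtain P where P: "g p = ereal P" by auto
  assume u: "g u = ereal r"
  have ineq: "(z - p) \<bullet> (u - p) - t * (norm (u - p))\<^sup>2 / 2 \<le> \<eta> * (r - P)" if t: "0 < t" "t \<le> 1" for t
  proof -
    define y where "y = (1 - t) *\<^sub>R p + t *\<^sub>R u"
    have "g y \<le> ereal (1 - t) * g p + ereal t * g u"
      using assms(2) t unfolding convex_fun_def y_def by simp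
    then have gy: "g y \<le> ereal ((1 - t) * P + t * r)"
      by (simp add: u P)
    then obtain Y where Y: "g y = ereal Y"
      using nm[of y] by (cases "g y") auto
    have "(norm (p - z))\<^sup>2 / 2 + \<eta> * P \<le> (norm (y - z))\<^sup>2 / 2 + \<eta> * Y"
      using min[of y] by (simp add: prox_objective_def P Y)
    moreover have "\<eta> * Y \<le> \<eta> * ((1 - t) * P + t * r)"
      using gy \<open>0 < \<eta>\<close> by (simp add: Y)
    moreover have "(norm (y - z))\<^sup>2 = (norm (p - z))\<^sup>2 - 2 * t * ((z - p) \<bullet> (u - p)) + t\<^sup>2 * (norm (u - p))\<^sup>2"
      unfolding y_def power2_norm_eq_inner
      by (simp add: inner_diff_left inner_diff_right inner_add_left inner_add_right
          inner_commute power2_eq_square algebra_simps)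
    ultimately have "t * ((z - p) \<bullet> (u - p) - t * (norm (u - p))\<^sup>2 / 2) \<le> t * (\<eta> * (r - P))"
      by (simp add: power2_eq_square algebra_simps)
    then show ?thesis
      using t(1) by simp
  qed
  have "(z - p) \<bullet> (u - p) \<le> \<eta> * (r - P)"
  proof (rule tendsto_upperbound)
    show "((\<lambda>t. (z - p) \<bullet> (u - p) - t * (norm (u - p))\<^sup>2 / 2) \<longlongrightarrow> (z - p) \<bullet> (u - p)) (at_right 0)"
      by (auto intro!: tendsto_eq_intros)
    show "\<forall>\<^sub>F t in at_right 0. (z - p) \<bullet> (u - p) - t * (norm (u - p))\<^sup>2 / 2 \<le> \<eta> * (r - P)"
      using eventually_at_right_real[OF zero_less_one] by eventually_elim (use ineq in auto)
  qed simp
  then show "real_of_ereal (g p) + (z - p) \<bullet> (u - p) / \<eta> \<le> r"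
    using \<open>0 < \<eta>\<close> by (simp add: P field_simps)
qed

section \<open>One inexact step compared with an arbitrary point\<close>

text \<open>Smoothness is used twice from \<open>v\<close>: upwards to \<open>xp\<close> and
  downwards to \<open>u\<close>. Polarization turns the inner product of \<open>v - xp\<close> and
  \<open>u - xp\<close> into squares. Taking \<open>u = v\<close> gives descent, taking
  \<open>u\<close> as the previous iterate gives the energy estimate.\<close>

lemma inexact_prox_step:
  fixes f :: "'a::euclidean_space \<Rightarrow> real" and g :: "'a \<Rightarrow> ereal"
  defines "G \<equiv> \<lambda>u. real_of_ereal (g u)"
  assumes diff: "\<And>u. f differentiable (at u)" and lip: "L-lipschitz_on UNIV (gradient f)"
    and g: "proper_fun g" "lsc_fun g" "convex_fun g"
    and "0 < \<eta>"
    and xp: "xp = forward_step \<eta> f v - \<eta> *\<^sub>R w"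
    and gap: "ereal e = prox_objective \<eta> g (forward_step \<eta> f v) xp
                    - dual_objective \<eta> g (forward_step \<eta> f v) w"
    and p: "p = prox \<eta> g (forward_step \<eta> f v)"
  shows "\<bar>g xp\<bar> \<noteq> \<infinity>"
    and "(norm (xp - p))\<^sup>2 \<le> e"
    and "g u \<noteq> \<infinity> \<Longrightarrow>
      f xp + G xp + 1 / \<eta> / 2 * (norm (xp - u))\<^sup>2 + (1 / \<eta> - L) / 2 * (norm (xp - v))\<^sup>2
        + max 0 (1 / \<eta> * ((xp - p) \<bullet> (u - p)))
      \<le> f u + G u + (1 / \<eta> + L) / 2 * (norm (v - u))\<^sup>2 + 1 / \<eta> * e"
proof -
  define z where "z = forward_step \<eta> f v"
  define \<rho> where "\<rho> = 1 / \<eta>"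
  have "\<rho> > 0" using \<open>0 < \<eta>\<close> by (simp add: \<rho>_def)
  have nm: "g u \<noteq> -\<infinity>" for u
    using g(1) by (simp add: proper_fun_def)
  note gap' = dual_gap_subgradient[OF g(1) \<open>0 < \<eta>\<close> xp gap]
  show fin: "\<bar>g xp\<bar> \<noteq> \<infinity>"
    by (rule gap'(1))
  have sub: "G xp + w \<bullet> (u - xp) - \<rho> * e \<le> r" if "g u = ereal r" for u r
    using gap'(2)[OF that] by (simp add: G_def \<rho>_def)
  have "prox_objective \<eta> g z p \<le> prox_objective \<eta> g z u" for u
    unfolding p z_def
  proof (rule prox_minimizes[OF g(1,2) \<open>0 < \<eta>\<close>])
    show "w \<bullet> u - (\<rho> * e + w \<bullet> xp - G xp) \<le> r" if "g u = ereal r" for u r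
      using sub[OF that] by (simp add: inner_diff_right)
  qed
  note ps = prox_subgradient[OF g(1,3) \<open>0 < \<eta>\<close> this]
  have psub: "G p + \<rho> * ((z - p) \<bullet> (u - p)) \<le> r" if "g u = ereal r" for u r
    using ps(2)[OF that] by (simp add: G_def \<rho>_def)
  have gp: "g p = ereal (G p)" and gxp: "g xp = ereal (G xp)"
    using ps(1) fin by (simp_all add: G_def ereal_real')
  \<comment> \<open>The left side is an exact subgradient at \<open>p\<close>; it differs from
    \<open>w\<close> by \<open>\<rho>\<close> times the error of the step.\<close>
  have zp: "\<rho> *\<^sub>R (z - p) = \<rho> *\<^sub>R (xp - p) + w"
    using \<open>0 < \<eta>\<close> by (simp add: xp z_def \<rho>_def scaleR_diff_right)
  have w: "w = \<rho> *\<^sub>R (v - xp) - gradient f v"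
    using \<open>0 < \<eta>\<close> by (simp add: xp forward_step_def \<rho>_def scaleR_diff_right scaleR_add_right)
  \<comment> \<open>The exact subgradient leads from \<open>u\<close> to \<open>p\<close>, the
    approximate one from \<open>p\<close> to \<open>xp\<close>. Compared with \<open>sub\<close>
    this gains the cross term when that is positive; choosing the better of the two bounds gives the
    \<open>max\<close> below.\<close>
  have T: "G xp + w \<bullet> (u - xp) + \<rho> * ((xp - p) \<bullet> (u - p)) - \<rho> * e \<le> r" if "g u = ereal r" for u r
  proof -
    have "\<rho> * ((z - p) \<bullet> (u - p)) = \<rho> * ((xp - p) \<bullet> (u - p)) + w \<bullet> (u - p)"
      using arg_cong[OF zp, of "\<lambda>a. a \<bullet> (u - p)"] by (simp add: inner_add_left)
    with psub[OF that] sub[OF gp] show ?thesis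
      by (simp add: inner_diff_right)
  qed
  show "(norm (xp - p))\<^sup>2 \<le> e"
    using T[OF gxp] \<open>\<rho> > 0\<close> by (simp add: power2_norm_eq_inner)
  assume "g u \<noteq> \<infinity>"
  with nm[of u] have gu: "g u = ereal (G u)"
    by (cases "g u") (auto simp: G_def)
  have main: "G xp + w \<bullet> (u - xp) + max 0 (\<rho> * ((xp - p) \<bullet> (u - p))) - \<rho> * e \<le> G u"
    using T[OF gu] sub[OF gu] by (simp add: max_def)
  have fx: "f xp \<le> f v + gradient f v \<bullet> (xp - v) + L / 2 * (norm (xp - v))\<^sup>2"
    by (rule lipschitz_gradient_upper_bound[OF diff lip])
  have fu: "f v + gradient f v \<bullet> (u - v) - L / 2 * (norm (v - u))\<^sup>2 \<le> f u"
    using lipschitz_gradient_lower_bound[OF diff lip, of v u] by (simp add: norm_minus_commute)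
  have "w \<bullet> (u - xp) = \<rho> * ((v - xp) \<bullet> (u - xp)) - gradient f v \<bullet> (u - xp)"
    by (subst w) (simp add: inner_diff_left)
  moreover have "(v - xp) \<bullet> (u - xp) = ((norm (xp - v))\<^sup>2 + (norm (xp - u))\<^sup>2 - (norm (v - u))\<^sup>2) / 2"
    by (simp add: power2_norm_eq_inner inner_diff_left inner_diff_right inner_commute)
  ultimately have "w \<bullet> (u - xp)
      = \<rho> / 2 * ((norm (xp - v))\<^sup>2 + (norm (xp - u))\<^sup>2 - (norm (v - u))\<^sup>2) - gradient f v \<bullet> (u - xp)"
    by simp
  with main fx fu have "f xp + G xp + \<rho> / 2 * (norm (xp - u))\<^sup>2 + (\<rho> - L) / 2 * (norm (xp - v))\<^sup>2
        + max 0 (\<rho> * ((xp - p) \<bullet> (u - p))) \<le> f u + G u + (\<rho> + L) / 2 * (norm (v - u))\<^sup>2 + \<rho> * e"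
    by (simp add: inner_diff_right field_simps)
  then show "f xp + G xp + 1 / \<eta> / 2 * (norm (xp - u))\<^sup>2 + (1 / \<eta> - L) / 2 * (norm (xp - v))\<^sup>2
        + max 0 (1 / \<eta> * ((xp - p) \<bullet> (u - p)))
      \<le> f u + G u + (1 / \<eta> + L) / 2 * (norm (v - u))\<^sup>2 + 1 / \<eta> * e"
    by (simp add: \<rho>_def)
qed

text \<open>For \<open>A = v - xp\<close>, \<open>B = v - p\<close>, \<open>d = xp - p\<close> the
  subtracted maximum is \<tau>, so the last factor is the smaller of \<open>e\<close> and the
  positive part of \<open>d \<bullet> B\<close>. If \<open>d \<bullet> B\<close> is at most
  \<open>e\<close>, expanding the square suffices because the conjugate exponent is at least 2;
  otherwise Young's inequality with weight \<open>s - 1\<close> applies.\<close>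

lemma norm_square_tradeoff:
  fixes A B d :: "'a::real_inner"
  assumes "1 < s" "s \<le> 2" "B = A + d" "(norm d)\<^sup>2 \<le> e"
  shows "(norm B)\<^sup>2 \<le> s * (norm A)\<^sup>2 + s / (s - 1) * (e - max 0 (e - max 0 (d \<bullet> B)))"
proof -
  have s': "2 \<le> s / (s - 1)"
    using assms(1,2) by (simp add: field_simps)
  have nB: "(norm B)\<^sup>2 = (norm A)\<^sup>2 + 2 * (d \<bullet> B) - (norm d)\<^sup>2"
    by (simp add: assms(3) power2_norm_eq_inner inner_add_left inner_add_right inner_commute)
  have sA: "(norm A)\<^sup>2 \<le> s * (norm A)\<^sup>2"
    using assms(1) by (simp add: mult_le_cancel_right1)
  have e0: "0 \<le> e" using assms(4) by (meson order_trans zero_le_power2)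
  consider "d \<bullet> B \<le> 0" | "0 < d \<bullet> B" "d \<bullet> B \<le> e" | "0 < d \<bullet> B" "e < d \<bullet> B" by linarith
  then show ?thesis
  proof cases
    case 1
    then show ?thesis using nB sA e0 zero_le_power2[of "norm d"] by (simp add: max_def; linarith)
  next
    case 2
    have "2 * (d \<bullet> B) \<le> s / (s - 1) * (d \<bullet> B)"
      using s' 2(1) by (intro mult_right_mono) auto
    then show ?thesis using 2 nB sA zero_le_power2[of "norm d"] by (simp add: max_def; linarith)
  next
    case 3
    define t where "t = s - 1"
    have t: "0 < t" using assms(1) by (simp add: t_def)
    have "0 \<le> (norm (t *\<^sub>R A - d))\<^sup>2 / t" using t by simp
    also have "\<dots> = t * (norm A)\<^sup>2 - 2 * (A \<bullet> d) + (norm d)\<^sup>2 / t"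
      using t by (simp add: power2_norm_eq_inner inner_diff_left inner_diff_right inner_commute field_simps)
    finally have "2 * (A \<bullet> d) \<le> t * (norm A)\<^sup>2 + (norm d)\<^sup>2 / t" by simp
    moreover have "(norm B)\<^sup>2 = (norm A)\<^sup>2 + 2 * (A \<bullet> d) + (norm d)\<^sup>2"
      by (simp add: assms(3) power2_norm_eq_inner inner_add_left inner_add_right inner_commute)
    moreover have "s / (s - 1) * (norm d)\<^sup>2 = (norm d)\<^sup>2 + (norm d)\<^sup>2 / t"
      using t by (simp add: t_def field_simps)
    moreover have "s / (s - 1) * (norm d)\<^sup>2 \<le> s / (s - 1) * e"
      using s' assms(4) by (intro mult_left_mono) auto
    moreover have "s * (norm A)\<^sup>2 = (norm A)\<^sup>2 + t * (norm A)\<^sup>2"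
      by (simp add: t_def algebra_simps)
    ultimately show ?thesis using 3 e0 by (simp add: max_def)
  qed
qed

section \<open>Nonmonotone descent\<close>

definition window_max :: "nat \<Rightarrow> (nat \<Rightarrow> real) \<Rightarrow> nat \<Rightarrow> real" where
  "window_max q \<Phi> k = Max (\<Phi> ` window q k)"

text \<open>The start index \<open>k0\<close> skips windows in which the objective may be infinite:
  it will be 1 if the first iterate has a finite value, and \<open>q + 2\<close> in general.\<close>

locale nonmonotone_descent =
  fixes \<Phi> a \<tau> :: "nat \<Rightarrow> real" and \<beta> \<rho> :: real and q k0 :: nat and \<phi> :: "nat \<Rightarrow> nat"
  assumes k0: "1 \<le> k0" and a_nonneg: "\<And>i. 0 \<le> a i" and \<tau>_nonneg: "\<And>i. 0 \<le> \<tau> i"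
    and \<beta>: "0 < \<beta>" and \<rho>: "0 < \<rho>"
    and descent: "\<And>i. k0 \<le> i \<Longrightarrow> \<Phi> (Suc i) \<le> window_max q \<Phi> i - \<beta> * a i + \<rho> * \<tau> i"
    and \<phi>_window: "\<And>k. 1 \<le> k \<Longrightarrow> \<phi> k \<in> window q k"
    and \<phi>_min: "\<And>k i. i \<in> window q k \<Longrightarrow> a (\<phi> k) \<le> a i"
begin

lemma finite_window [simp]: "finite (window q k)"
  by (simp add: window_def)

lemma window_max_ge: "i \<in> window q k \<Longrightarrow> \<Phi> i \<le> window_max q \<Phi> k"
  unfolding window_max_def by (rule Max_ge) auto

lemma window_max_leI: "1 \<le> k \<Longrightarrow> (\<And>i. i \<in> window q k \<Longrightarrow> \<Phi> i \<le> M) \<Longrightarrow> window_max q \<Phi> k \<le> M"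
  unfolding window_max_def by (rule Max.boundedI) (auto simp: window_def)

lemma window_max_Suc:
  assumes "k0 \<le> i"
  shows "window_max q \<Phi> (Suc i) \<le> window_max q \<Phi> i + \<rho> * \<tau> i"
proof (rule window_max_leI)
  fix j assume "j \<in> window q (Suc i)"
  then consider "j \<in> window q i" | "j = Suc i"
    by (force simp: window_def)
  then show "\<Phi> j \<le> window_max q \<Phi> i + \<rho> * \<tau> i"
  proof cases
    case 1
    have "0 \<le> \<rho> * \<tau> i" using \<rho> \<tau>_nonneg by simp
    then show ?thesis using window_max_ge[OF 1] by linarith
  next
    case 2
    have "0 \<le> \<beta> * a i" using \<beta> a_nonneg by simp
    then show ?thesis using descent[OF assms] 2 by simp
  qed
qed simp

lemma window_max_le:
  assumes "k0 \<le> m" "m \<le> i"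
  shows "window_max q \<Phi> i \<le> window_max q \<Phi> m + \<rho> * sum \<tau> {m..<i}"
  using assms(2)
proof (induction i rule: dec_induct)
  case (step i)
  then show ?case
    using window_max_Suc[of i] assms(1) by (simp add: distrib_left)
qed simp

text \<open>After \<open>q + 1\<close> steps every index in the window was produced by one of these
  steps, so each value carries its own decrease, which is at least the smallest one.\<close>

lemma window_max_block:
  assumes "k0 \<le> m"
  shows "window_max q \<Phi> (Suc (m + q)) + \<beta> * a (\<phi> (m + q)) \<le> window_max q \<Phi> m + \<rho> * sum \<tau> {m..m + q}"
proof -
  have "window_max q \<Phi> (Suc (m + q)) \<le> window_max q \<Phi> m + \<rho> * sum \<tau> {m..m + q} - \<beta> * a (\<phi> (m + q))"
  proof (rule window_max_leI)
    fix j assume j: "j \<in> window q (Suc (m + q))"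
    define i where "i = j - 1"
    have i: "j = Suc i" "m \<le> i" "i \<le> m + q"
      using j assms k0 by (auto simp: window_def i_def)
    then have "i \<in> window q (m + q)"
      using assms k0 by (simp add: window_def)
    then have "\<beta> * a (\<phi> (m + q)) \<le> \<beta> * a i"
      using \<beta> \<phi>_min by simp
    moreover have "\<Phi> j \<le> window_max q \<Phi> m + \<rho> * sum \<tau> {m..<i} - \<beta> * a i + \<rho> * \<tau> i"
      using descent[of i] window_max_le[of m i] i assms by simp
    moreover have "\<rho> * (sum \<tau> {m..<i} + \<tau> i) \<le> \<rho> * sum \<tau> {m..m + q}"
    proof -
      have "sum \<tau> {m..<i} + \<tau> i = sum \<tau> {m..i}"
        using i by (simp add: sum.last_plus)
      also have "\<dots> \<le> sum \<tau> {m..m + q}"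
        using i \<tau>_nonneg by (intro sum_mono2) auto
      finally show ?thesis using \<rho> by simp
    qed
    ultimately show "\<Phi> j \<le> window_max q \<Phi> m + \<rho> * sum \<tau> {m..m + q} - \<beta> * a (\<phi> (m + q))"
      by (simp add: distrib_left)
  qed simp
  then show ?thesis by simp
qed

lemma selected_tendsto_zero:
  assumes "summable \<tau>" and low: "\<And>i. k0 \<le> i \<Longrightarrow> B \<le> \<Phi> i"
  shows "(\<lambda>k. a (\<phi> k)) \<longlonglongrightarrow> 0"
proof -
  define W where "W i = window_max q \<Phi> i" for i
  define S where "S i = (\<Sum>j<i. \<tau> j)" for i
  have "(\<lambda>n. sum \<tau> {..<n}) = S"
    by (simp add: S_def fun_eq_iff)
  then have Sconv: "convergent S"
    using assms(1) by (simp add: summable_iff_convergent)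
  have WB: "B \<le> W i" if "k0 \<le> i" for i
    using window_max_ge[of i i] low[of i] that k0 by (auto simp: W_def window_def)
  have Sle: "S i \<le> suminf \<tau>" for i
    unfolding S_def using assms(1) \<tau>_nonneg by (intro sum_le_suminf) auto
  \<comment> \<open>Removing the accumulated errors makes the window maximum monotone; it is bounded
    below, hence \<open>W\<close> converges and the block decreases vanish.\<close>
  define Y where "Y i = W (i + k0) - \<rho> * S (i + k0)" for i
  have "decseq Y"
    unfolding decseq_Suc_iff
  proof
    fix i show "Y (Suc i) \<le> Y i"
      using window_max_Suc[of "i + k0"] by (simp add: Y_def W_def S_def distrib_left)
  qed
  moreover have "B - \<rho> * suminf \<tau> \<le> Y i" for i
    using WB[of "i + k0"] Sle[of "i + k0"] k0 \<rho> mult_left_mono[of "S (i + k0)" "suminf \<tau>" \<rho>]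
    unfolding Y_def by linarith
  ultimately have "convergent Y"
    by (metis decseq_convergent convergent_def)
  moreover have "convergent (\<lambda>i. \<rho> * S (i + k0))"
    using Sconv by (intro convergent_mult convergent_const) (simp add: convergent_ignore_initial_segment)
  ultimately have "convergent (\<lambda>i. Y i + \<rho> * S (i + k0))"
    by (rule convergent_add)
  then have "convergent W"
    by (simp add: Y_def convergent_ignore_initial_segment)
  then obtain l where l: "W \<longlonglongrightarrow> l" by (auto simp: convergent_def)
  from Sconv obtain t where t: "S \<longlonglongrightarrow> t" by (auto simp: convergent_def)
  have up: "a (\<phi> (m + q)) \<le> (W m - W (m + Suc q) + \<rho> * (S (m + Suc q) - S m)) / \<beta>" if "k0 \<le> m" for m
  proof -
    have "S (m + Suc q) = S m + sum \<tau> {m..m + q}"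
      using sum.atLeastLessThan_concat[of 0 m "m + Suc q" \<tau>]
      by (simp add: S_def lessThan_atLeast0 flip: atLeastLessThanSuc_atLeastAtMost)
    then show ?thesis
      using window_max_block[OF that] \<beta> by (simp add: W_def field_simps)
  qed
  have "(\<lambda>m. a (\<phi> (m + q))) \<longlonglongrightarrow> 0"
  proof (rule tendsto_sandwich)
    show "\<forall>\<^sub>F m in sequentially. 0 \<le> a (\<phi> (m + q))"
      using a_nonneg by simp
    show "\<forall>\<^sub>F m in sequentially.
        a (\<phi> (m + q)) \<le> (W m - W (m + Suc q) + \<rho> * (S (m + Suc q) - S m)) / \<beta>"
      using eventually_ge_at_top[of k0] by eventually_elim (rule up)
    have "(\<lambda>m. (W m - W (m + Suc q) + \<rho> * (S (m + Suc q) - S m)) / \<beta>)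
        \<longlonglongrightarrow> (l - l + \<rho> * (t - t)) / \<beta>"
      using \<beta> by (intro tendsto_intros l t LIMSEQ_ignore_initial_segment) auto
    then show "(\<lambda>m. (W m - W (m + Suc q) + \<rho> * (S (m + Suc q) - S m)) / \<beta>) \<longlonglongrightarrow> 0"
      by simp
  qed simp
  then show ?thesis
    by (rule LIMSEQ_offset)
qed

text \<open>The block decreases telescope. The number \<open>m\<close> stands for a lower bound of
  the squared proximal mapping at the selected index of each block.\<close>

lemma block_sum:
  fixes \<epsilon> :: "nat \<Rightarrow> real"
  assumes "k0 \<le> Suc r" "0 \<le> s" "0 \<le> s'" and \<tau>\<epsilon>: "\<And>i. 1 \<le> i \<Longrightarrow> \<tau> i \<le> \<epsilon> i"
    and m: "\<And>j. j < n \<Longrightarrow> m \<le> s * a (\<phi> (r + Suc j * Suc q)) + s' * (\<epsilon> (\<phi> (r + Suc j * Suc q)) - \<tau> (\<phi> (r + Suc j * Suc q)))"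
  shows "\<beta> * real n * m + s * window_max q \<Phi> (Suc (r + n * Suc q))
    \<le> s * window_max q \<Phi> (Suc r) + max (s * \<rho>) (s' * \<beta>) * sum \<epsilon> {Suc r..r + n * Suc q}"
  using m
proof (induction n)
  case (Suc n)
  define R where "R = r + n * Suc q"
  define k where "k = Suc R + q"
  have k: "r + Suc n * Suc q = k" by (simp add: k_def R_def)
  define M where "M = max (s * \<rho>) (s' * \<beta>)"
  have IH: "\<beta> * real n * m + s * window_max q \<Phi> (Suc R) \<le> s * window_max q \<Phi> (Suc r) + M * sum \<epsilon> {Suc r..R}"
    using Suc by (simp add: R_def M_def)
  have "m \<le> s * a (\<phi> k) + s' * (\<epsilon> (\<phi> k) - \<tau> (\<phi> k))"
    using Suc.prems[of n] by (simp only: k)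
  then have "\<beta> * m \<le> \<beta> * (s * a (\<phi> k) + s' * (\<epsilon> (\<phi> k) - \<tau> (\<phi> k)))"
    using \<beta> by (intro mult_left_mono) auto
  then have 1: "\<beta> * m \<le> s * (\<beta> * a (\<phi> k)) + s' * \<beta> * (\<epsilon> (\<phi> k) - \<tau> (\<phi> k))"
    by (simp add: algebra_simps)
  have "\<phi> k \<in> {Suc R..k}"
    using \<phi>_window[of k] by (auto simp: window_def k_def)
  then have "\<epsilon> (\<phi> k) - \<tau> (\<phi> k) \<le> (\<Sum>i\<in>{Suc R..k}. \<epsilon> i - \<tau> i)"
    using \<tau>\<epsilon> by (intro member_le_sum) auto
  then have 2: "s' * \<beta> * (\<epsilon> (\<phi> k) - \<tau> (\<phi> k)) \<le> s' * \<beta> * (sum \<epsilon> {Suc R..k} - sum \<tau> {Suc R..k})"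
    using \<beta> \<open>0 \<le> s'\<close> by (intro mult_left_mono) (auto simp: sum_subtractf)
  have "window_max q \<Phi> (Suc k) + \<beta> * a (\<phi> k) \<le> window_max q \<Phi> (Suc R) + \<rho> * sum \<tau> {Suc R..k}"
    using window_max_block[of "Suc R"] assms(1) by (simp add: k_def R_def)
  then have "s * (window_max q \<Phi> (Suc k) + \<beta> * a (\<phi> k)) \<le> s * (window_max q \<Phi> (Suc R) + \<rho> * sum \<tau> {Suc R..k})"
    using \<open>0 \<le> s\<close> by (rule mult_left_mono)
  then have 3: "s * window_max q \<Phi> (Suc k) + s * (\<beta> * a (\<phi> k)) \<le> s * window_max q \<Phi> (Suc R) + s * \<rho> * sum \<tau> {Suc R..k}"
    by (simp add: algebra_simps)
  \<comment> \<open>The errors of a block split into \<tau> and \<epsilon> - \<tau>: descent charges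
    \<open>s * \<rho>\<close> for the first part and the defect charges \<open>s' * \<beta>\<close>
    for the second, so the larger coefficient covers both.\<close>
  have 4: "s * \<rho> * sum \<tau> {Suc R..k} + s' * \<beta> * (sum \<epsilon> {Suc R..k} - sum \<tau> {Suc R..k}) \<le> M * sum \<epsilon> {Suc R..k}"
  proof -
    have "s * \<rho> * sum \<tau> {Suc R..k} \<le> M * sum \<tau> {Suc R..k}"
      using \<tau>_nonneg by (intro mult_right_mono) (auto simp: M_def intro: sum_nonneg)
    moreover have "s' * \<beta> * (sum \<epsilon> {Suc R..k} - sum \<tau> {Suc R..k}) \<le> M * (sum \<epsilon> {Suc R..k} - sum \<tau> {Suc R..k})"
      using \<tau>\<epsilon> by (intro mult_right_mono) (auto simp: M_def intro: sum_mono)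
    ultimately show ?thesis by (simp add: algebra_simps)
  qed
  have "sum \<epsilon> {Suc r..k} = sum \<epsilon> {Suc r..R} + sum \<epsilon> {Suc R..k}"
    using sum.ub_add_nat[of "Suc r" R \<epsilon> "Suc q"] by (simp add: R_def k_def)
  then have "M * sum \<epsilon> {Suc r..k} = M * sum \<epsilon> {Suc r..R} + M * sum \<epsilon> {Suc R..k}"
    by (simp add: distrib_left)
  then show ?case
    using IH 1 2 3 4 unfolding k M_def[symmetric] by (simp add: algebra_simps)
qed simp

end

section \<open>Kinetic energy and the balance of the rate\<close>

text \<open>The kinetic term gained in one step pays for the momentum of the next one, so the
  energies telescope. The extra half of \<open>a 1\<close> later turns \<open>2 * r\<close> into
  \<open>2 * r + 1\<close>, a gain that small windows need.\<close>

lemma momentum_energy: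
  fixes \<Phi> a D \<epsilon> \<theta> :: "nat \<Rightarrow> real"
  assumes "0 < L" "L < \<rho>"
    and step: "\<And>i. 1 \<le> i \<Longrightarrow> \<Phi> (Suc i) + \<rho> / 2 * D (Suc i) + (\<rho> - L) / 2 * a i
                    \<le> \<Phi> i + (\<rho> + L) / 2 * ((\<theta> i)\<^sup>2 * D i) + \<rho> * \<epsilon> i"
    and \<theta>: "\<And>i. \<theta> i = (real i - 1) / (real i + 2)"
    and D: "\<And>i. 0 \<le> D i" "D 2 = a 1"
    and "1 \<le> r" "real (r + 3) * L \<le> 6 * \<rho>"
  shows "\<Phi> (Suc r) + (\<rho> + L) / 2 * ((\<theta> (Suc r))\<^sup>2 * D (Suc r)) + (\<rho> - L) / 2 * (sum a {1..r} + a 1 / 2)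
      \<le> \<Phi> 1 + \<rho> * sum \<epsilon> {1..r}"
  using assms(7,8)
proof (induction r rule: dec_induct)
  case base
  \<comment> \<open>The first step has no momentum, and the second uses only a small part of the
    kinetic term, where \<open>D 2 = a 1\<close>; the remainder pays for the extra half.\<close>
  have "\<theta> 1 = 0" "(\<theta> 2)\<^sup>2 = 1 / 16"
    by (simp_all add: \<theta> power_divide)
  then have "(\<rho> + L) / 2 * ((\<theta> 2)\<^sup>2 * D 2) = (\<rho> + L) / 32 * a 1" "\<theta> 1 = 0"
    by (simp_all add: D(2))
  moreover have "L * a 1 \<le> \<rho> * a 1"
    using assms(2) D(1)[of 2] D(2) by (intro mult_right_mono) auto
  moreover have "0 \<le> L * a 1"
    using assms(1) D(1)[of 2] D(2) by simp
  ultimately show ?case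
    using step[of 1] D(2) unfolding Suc_1 by (simp add: field_simps)
next
  case (step r)
  define t where "t = \<theta> (Suc (Suc r))"
  have rL: "L * (real r + 4) \<le> 6 * \<rho>"
    using step.prems by (simp add: algebra_simps)
  \<comment> \<open>The bound on \<open>r\<close> keeps the next momentum factor at most
    \<open>1 - L / (2 * \<rho>)\<close>, so its cost stays below the kinetic term just
    gained.\<close>
  have "0 \<le> t" "t = 1 - 3 / (real r + 4)"
    by (simp_all add: t_def \<theta> field_simps)
  moreover have "L / (2 * \<rho>) \<le> 3 / (real r + 4)"
    using rL assms(1,2) by (simp add: field_simps)
  ultimately have "t \<le> 1 - L / (2 * \<rho>)" by simp
  then have "t\<^sup>2 \<le> (1 - L / (2 * \<rho>))\<^sup>2"
    using \<open>0 \<le> t\<close> by (rule power_mono)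
  moreover have "(\<rho> + L) * (1 - L / (2 * \<rho>))\<^sup>2 \<le> \<rho>"
  proof -
    define l where "l = L / \<rho>"
    have l: "0 < l" "l < 1" "L = l * \<rho>"
      using assms(1,2) by (simp_all add: l_def)
    have "(1 + l) * (1 - l / 2)\<^sup>2 = 1 - l\<^sup>2 * (3 - l) / 4"
      by (simp add: power2_eq_square field_simps)
    also have "\<dots> \<le> 1"
      using l by simp
    finally have "\<rho> * ((1 + l) * (1 - l / 2)\<^sup>2) \<le> \<rho> * 1"
      using assms(1,2) by (intro mult_left_mono) auto
    then show ?thesis
      using l assms(1,2) by (simp add: algebra_simps)
  qed
  ultimately have "(\<rho> + L) * t\<^sup>2 \<le> \<rho>"
    using assms(1,2) mult_left_mono[of "t\<^sup>2" "(1 - L / (2 * \<rho>))\<^sup>2" "\<rho> + L"] by linarith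
  then have "(\<rho> + L) * t\<^sup>2 * D (Suc (Suc r)) \<le> \<rho> * D (Suc (Suc r))"
    using D(1) by (rule mult_right_mono)
  moreover have "real (r + 3) * L \<le> 6 * \<rho>"
    using rL assms(1) by (simp add: algebra_simps)
  note step.IH[OF this]
  moreover note assms(3)[of "Suc r"]
  ultimately show ?case
    unfolding t_def by (simp add: field_simps)
qed

text \<open>The exponent \<open>s\<close> of the full windows makes the coefficient \<open>Q s'\<close> of the errors equal to \<open>2 Q + 8\<close>, that is,
  it uses up the term \<open>8 c\<close> entirely; the coefficient \<open>Q s < 2 Q\<close> of the initial gap then leaves room for the
  first \<open>r\<close> indices.\<close>

lemma rate_arithmetic_early:
  fixes Q r n m \<alpha> d T\<^sub>1 C\<^sub>1 C\<^sub>2 L \<rho> :: real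
  assumes "1 \<le> r" "r + 1 \<le> Q" "0 < L" "L < \<rho>" "0 \<le> d" "0 \<le> C\<^sub>2" "0 \<le> T\<^sub>1" "T\<^sub>1 \<le> C\<^sub>1"
    and blocks: "\<And>s. 1 < s \<Longrightarrow> s \<le> 2 \<Longrightarrow> (\<rho> - L / 2) * n * m
        \<le> s * (d + \<rho> * T\<^sub>1) + max (s * \<rho>) (s / (s - 1) * (\<rho> - L / 2)) * C\<^sub>2"
    and first: "\<And>s. 1 < s \<Longrightarrow> s \<le> 2 \<Longrightarrow> m \<le> s * \<alpha> + s / (s - 1) * (C\<^sub>1 - T\<^sub>1)"
    and energy: "(\<rho> - L) * (2 * r + 1) * \<alpha> \<le> 4 * (d + \<rho> * C\<^sub>1)"
  shows "(n * Q + r) * m \<le> 8 * (C\<^sub>1 + C\<^sub>2) + 2 * Q * (d + \<rho> * (C\<^sub>1 + C\<^sub>2)) / (\<rho> - L)"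
proof -
  define \<gamma> \<beta> where "\<gamma> = \<rho> - L" and "\<beta> = \<rho> - L / 2"
  have \<gamma>: "0 < \<gamma>" "\<gamma> \<le> \<rho>" "\<gamma> \<le> \<beta>" "0 < \<beta>" "0 < \<rho>"
    using assms(3,4) by (auto simp: \<gamma>_def \<beta>_def)
  have Q: "2 \<le> Q" using assms(1,2) by simp
  define s where "s = (2 * Q + 8) / (Q + 8)"
  have "s - 1 = Q / (Q + 8)"
    using Q by (simp add: s_def field_simps)
  then have s: "1 < s" "s \<le> 2" "s / (s - 1) = (2 * Q + 8) / Q"
    using Q by (auto simp: s_def pos_divide_le_eq)
  \<comment> \<open>Coefficient obtained when the energy bound is divided by
    \<open>2 * r + 1\<close> and multiplied by \<open>r\<close>.\<close>
  define e where "e = 4 * r / (2 * r + 1)"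
  have e: "0 \<le> e" "e \<le> 2"
    using assms(1) by (simp_all add: e_def field_simps)
  have A: "\<gamma> * n * Q * m \<le> Q * s * (d + \<rho> * T\<^sub>1) + (2 * Q * \<rho> + 8 * \<gamma>) * C\<^sub>2"
  proof -
    \<comment> \<open>The factor \<open>h\<close> exchanges the block constant
      \<open>\<rho> - L / 2\<close> for the \<open>\<rho> - L\<close> of the claim.\<close>
    define h where "h = \<gamma> / \<beta>"
    have h: "0 \<le> h" "h \<le> 1" "h * \<beta> = \<gamma>"
      using \<gamma> by (simp_all add: h_def)
    have "Q * h * (\<beta> * n * m) \<le> Q * h * (s * (d + \<rho> * T\<^sub>1) + max (s * \<rho>) (s / (s - 1) * \<beta>) * C\<^sub>2)"
      using blocks[OF s(1,2)] Q h by (intro mult_left_mono) (auto simp: \<beta>_def)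
    moreover have eq: "\<gamma> * n * Q * m = Q * h * (\<beta> * n * m)"
      unfolding h(3)[symmetric] by simp
    moreover have "h * (Q * (s * (d + \<rho> * T\<^sub>1))) \<le> 1 * (Q * (s * (d + \<rho> * T\<^sub>1)))"
      using h Q s assms(5,7) \<gamma> by (intro mult_right_mono) auto
    moreover have "Q * h * max (s * \<rho>) (s / (s - 1) * \<beta>) \<le> 2 * Q * \<rho> + 8 * \<gamma>"
    proof (cases "s * \<rho> \<le> s / (s - 1) * \<beta>")
      case True
      have "Q * h * (s / (s - 1) * \<beta>) = (2 * Q + 8) * \<gamma>"
        using Q by (simp add: s(3) flip: h(3))
      also have "\<dots> \<le> 2 * Q * \<rho> + 8 * \<gamma>"
        using Q \<gamma> by (simp add: distrib_right)
      finally show ?thesis using True by simp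
    next
      case False
      have "h * s \<le> 1 * 2"
        using h s by (intro mult_mono) auto
      then have "(Q * \<rho>) * (h * s) \<le> (Q * \<rho>) * 2"
        using Q \<gamma> by (intro mult_left_mono) auto
      then show ?thesis using False \<gamma> by (simp add: algebra_simps)
    qed
    then have "Q * h * max (s * \<rho>) (s / (s - 1) * \<beta>) * C\<^sub>2 \<le> (2 * Q * \<rho> + 8 * \<gamma>) * C\<^sub>2"
      using assms(6) by (rule mult_right_mono)
    ultimately show ?thesis
      unfolding eq by (simp add: algebra_simps)
  qed
  have en: "r * \<gamma> * \<alpha> \<le> e * (d + \<rho> * C\<^sub>1)"
  proof -
    have "r * (\<gamma> * (2 * r + 1) * \<alpha>) / (2 * r + 1) \<le> r * (4 * (d + \<rho> * C\<^sub>1)) / (2 * r + 1)"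
      using energy assms(1) by (intro divide_right_mono mult_left_mono) (auto simp: \<gamma>_def)
    moreover have "r * (\<gamma> * (2 * r + 1) * \<alpha>) / (2 * r + 1) = r * \<gamma> * \<alpha>"
      using assms(1) by (simp add: field_simps)
    ultimately show ?thesis by (simp add: e_def mult_ac)
  qed
  have B: "\<gamma> * r * m \<le> u * e * (d + \<rho> * C\<^sub>1) + r * (u / (u - 1)) * \<gamma> * (C\<^sub>1 - T\<^sub>1)"
    if u: "1 < u" "u \<le> 2" for u
  proof -
    have "\<gamma> * r * m \<le> \<gamma> * r * (u * \<alpha> + u / (u - 1) * (C\<^sub>1 - T\<^sub>1))"
      using first[OF u] \<gamma> assms(1) by (intro mult_left_mono) auto
    moreover have "u * (r * \<gamma> * \<alpha>) \<le> u * (e * (d + \<rho> * C\<^sub>1))"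
      using en u by (intro mult_left_mono) auto
    ultimately show ?thesis by (simp add: algebra_simps)
  qed
  \<comment> \<open>The exponent \<open>u\<close> serves the first \<open>r\<close> indices. The two
    inequalities are the budgets for the coefficients of \<open>d\<close> and of
    \<open>C\<^sub>1 - T\<^sub>1\<close>; \<open>u = s\<close> works for small \<open>Q\<close> and
    \<open>u = 2\<close> for large \<open>Q\<close>.\<close>
  have "\<exists>u. 1 < u \<and> u \<le> 2 \<and> Q * s + u * e \<le> 2 * Q \<and> u * e * \<rho> + r * (u / (u - 1)) * \<gamma> \<le> 2 * Q * \<rho> + 8 * \<gamma>"
  proof (cases "Q \<le> 8")
    case True
    have "Q + 8 > 0" "2 * r + 1 > 0" using Q assms(1) by auto
    \<comment> \<open>With \<open>r\<close> at most \<open>Q - 1\<close> this reduces to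
      \<open>0 \<le> (Q - 2)\<^sup>2\<close>, with equality at \<open>Q = 2\<close>,
      \<open>r = 1\<close>.\<close>
    have r1: "(4 - Q) * r \<le> Q"
    proof (cases "Q \<le> 4")
      case True
      have "(4 - Q) * r \<le> (4 - Q) * (Q - 1)"
        using True assms(2) by (intro mult_left_mono) auto
      moreover have "0 \<le> (Q - 2)\<^sup>2" by simp
      ultimately show ?thesis by (simp add: power2_eq_square algebra_simps)
    next
      case False
      then have "(4 - Q) * r \<le> 0" using assms(1) by (intro mult_nonpos_nonneg) auto
      then show ?thesis using Q by simp
    qed
    have "(2 * Q + 8) * (4 * r) \<le> 8 * Q * (2 * r + 1)"
      using r1 by (simp add: algebra_simps)
    then have "(2 * Q + 8) * e \<le> 8 * Q"
      using \<open>2 * r + 1 > 0\<close> by (simp add: e_def field_simps)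
    then have c1: "Q * s + s * e \<le> 2 * Q"
    proof -
      have "Q * s + s * e = (2 * Q + 8) * (Q + e) / (Q + 8)"
        unfolding s_def by (simp add: add_divide_distrib[symmetric] ring_distribs mult_ac)
      also have "\<dots> \<le> 2 * Q"
        using \<open>(2 * Q + 8) * e \<le> 8 * Q\<close> \<open>Q + 8 > 0\<close> by (simp add: pos_divide_le_eq algebra_simps)
      finally show ?thesis .
    qed
    moreover have "s * e * \<rho> + r * (s / (s - 1)) * \<gamma> \<le> 2 * Q * \<rho> + 8 * \<gamma>"
    proof -
      have "r * (s / (s - 1)) \<le> (Q - 1) * (s / (s - 1))"
        using assms(2) s Q by (intro mult_right_mono) auto
      also have "\<dots> = 2 * Q + 6 - 8 / Q"
        using Q by (simp add: s(3) field_simps)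
      also have "\<dots> \<le> 2 * Q + 8 - s * e"
      proof -
        have "s * e \<le> s * 2" using e s by (intro mult_left_mono) auto
        moreover have "s * 2 \<le> 2 + 8 / Q"
        proof -
          have "0 \<le> (8 - Q) * (Q + 4)" using True Q by simp
          then show ?thesis using Q True by (simp add: s_def field_simps)
        qed
        ultimately show ?thesis by simp
      qed
      finally have "r * (s / (s - 1)) * \<gamma> \<le> (2 * Q + 8 - s * e) * \<gamma>"
        using \<gamma> by (intro mult_right_mono) auto
      moreover have "(2 * Q - s * e) * \<gamma> \<le> (2 * Q - s * e) * \<rho>"
      proof (rule mult_left_mono)
        have "0 \<le> Q * s" using Q s by simp
        then show "0 \<le> 2 * Q - s * e" using c1 by linarith
      qed (use \<gamma> in auto)
      ultimately show ?thesis by (simp add: algebra_simps)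
    qed
    ultimately show ?thesis using s by blast
  next
    case False
    have "Q * s + 2 * e \<le> 2 * Q"
    proof -
      \<comment> \<open>The slack \<open>2 * Q - Q * s\<close> equals
        \<open>8 * Q / (Q + 8)\<close>, which is at least 4 once \<open>Q\<close> is at least
        8.\<close>
      have "4 * (Q + 8) \<le> 8 * Q" using False by simp
      then have "Q * s + 4 \<le> 2 * Q" using Q by (simp add: s_def field_simps)
      then show ?thesis using e by simp
    qed
    moreover have "2 * e * \<rho> + r * (2 / (2 - 1)) * \<gamma> \<le> 2 * Q * \<rho> + 8 * \<gamma>"
    proof -
      have "2 * e * \<rho> \<le> 4 * \<rho>" using e \<gamma> by simp
      moreover have "2 * r * \<gamma> \<le> (2 * Q - 2) * \<gamma>" using assms(2) \<gamma> by (intro mult_right_mono) auto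
      moreover have "(2 * Q - 4) * \<gamma> \<le> (2 * Q - 4) * \<rho>" using Q \<gamma> by (intro mult_left_mono) auto
      then have "(2 * Q - 2) * \<gamma> + 4 * \<rho> \<le> 2 * Q * \<rho> + 8 * \<gamma>" using \<gamma> by (simp add: algebra_simps)
      moreover have "r * (2 / (2 - 1)) * \<gamma> = 2 * r * \<gamma>" by simp
      ultimately show ?thesis by linarith
    qed
    ultimately show ?thesis by (intro exI[of _ 2]) simp
  qed
  then obtain u where u: "1 < u" "u \<le> 2" and c1: "Q * s + u * e \<le> 2 * Q"
    and C1: "u * e * \<rho> + r * (u / (u - 1)) * \<gamma> \<le> 2 * Q * \<rho> + 8 * \<gamma>"
    by blast
  have "\<gamma> * ((n * Q + r) * m) \<le> 8 * \<gamma> * (C\<^sub>1 + C\<^sub>2) + 2 * Q * (d + \<rho> * (C\<^sub>1 + C\<^sub>2))"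
  proof -
    \<comment> \<open>With \<open>C\<^sub>1\<close> written as
      \<open>T\<^sub>1 + (C\<^sub>1 - T\<^sub>1)\<close>, the coefficients of \<open>d\<close>,
      \<open>T\<^sub>1\<close>, \<open>C\<^sub>1 - T\<^sub>1\<close> and \<open>C\<^sub>2\<close>
      are compared separately.\<close>
    have "(Q * s + u * e) * d \<le> 2 * Q * d"
      using c1 assms(5) by (rule mult_right_mono)
    moreover have "(Q * s + u * e) * (\<rho> * T\<^sub>1) \<le> 2 * Q * (\<rho> * T\<^sub>1)"
      using c1 assms(7) \<gamma> by (intro mult_right_mono) auto
    moreover have "(u * e * \<rho> + r * (u / (u - 1)) * \<gamma>) * (C\<^sub>1 - T\<^sub>1) \<le> (2 * Q * \<rho> + 8 * \<gamma>) * (C\<^sub>1 - T\<^sub>1)"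
      using C1 assms(8) by (intro mult_right_mono) auto
    moreover have "0 \<le> \<gamma> * T\<^sub>1" using \<gamma> assms(7) by simp
    ultimately show ?thesis
      using A B[OF u] by (simp add: algebra_simps)
  qed
  then have "(n * Q + r) * m \<le> (8 * \<gamma> * (C\<^sub>1 + C\<^sub>2) + 2 * Q * (d + \<rho> * (C\<^sub>1 + C\<^sub>2))) / \<gamma>"
    using \<gamma> by (simp add: field_simps)
  also have "\<dots> = 8 * (C\<^sub>1 + C\<^sub>2) + 2 * Q * (d + \<rho> * (C\<^sub>1 + C\<^sub>2)) / \<gamma>"
    using \<gamma> by (simp add: field_simps)
  finally show ?thesis by (simp add: \<gamma>_def)
qed

text \<open>For large \<open>r\<close> the energy is only available up to an index \<open>R \<approx> 6 \<rho> / L\<close>. The first \<open>r\<close> indices are then paid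
  for by the difference between \<open>1 / (\<rho> - L)\<close> and \<open>1 / (\<rho> - L / 2)\<close>.\<close>

lemma rate_arithmetic_late:
  fixes Q r n m \<alpha> d T\<^sub>1 C\<^sub>1 C\<^sub>2 L \<rho> R :: real
  assumes "0 \<le> r" "r \<le> Q" "0 < L" "L < \<rho>" "0 \<le> d" "0 \<le> C\<^sub>2" "0 \<le> T\<^sub>1" "T\<^sub>1 \<le> C\<^sub>1"
    and blocks: "(\<rho> - L / 2) * n * m \<le> 2 * (d + \<rho> * T\<^sub>1) + 2 * \<rho> * C\<^sub>2"
    and first: "r = 0 \<or> m \<le> 2 * \<alpha> + 2 * (C\<^sub>1 - T\<^sub>1)"
    and energy: "r = 0 \<or> (\<rho> - L) * (2 * R + 1) * \<alpha> \<le> 4 * (d + \<rho> * C\<^sub>1) \<and> 6 * \<rho> \<le> (R + 4) * L"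
  shows "(n * Q + r) * m \<le> 8 * (C\<^sub>1 + C\<^sub>2) + 2 * Q * (d + \<rho> * (C\<^sub>1 + C\<^sub>2)) / (\<rho> - L)"
proof -
  \<comment> \<open>Here \<open>k = 1 - h\<close> is the fraction saved on the blocks by passing
    from \<open>\<beta>\<close> to \<open>\<gamma>\<close>.\<close>
  define \<gamma> \<beta> h k where "\<gamma> = \<rho> - L" and "\<beta> = \<rho> - L / 2" and "h = \<gamma> / \<beta>" and "k = L / (2 * \<rho> - L)"
  have \<gamma>: "0 < \<gamma>" "\<gamma> \<le> \<rho>" "\<gamma> \<le> \<beta>" "0 < \<beta>" "0 < \<rho>"
    using assms(3,4) by (auto simp: \<gamma>_def \<beta>_def)
  have k: "0 \<le> k" "h = 1 - k" "h * \<beta> = \<gamma>" "0 \<le> h"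
    using assms(3,4) \<gamma> by (auto simp: k_def h_def \<gamma>_def \<beta>_def field_simps)
  have Q: "0 \<le> Q" using assms(1,2) by simp
  have C1: "0 \<le> C\<^sub>1" using assms(7,8) by simp
  have A: "\<gamma> * n * Q * m \<le> 2 * Q * h * (d + \<rho> * T\<^sub>1 + \<rho> * C\<^sub>2)"
  proof -
    have "Q * h * (\<beta> * n * m) \<le> Q * h * (2 * (d + \<rho> * T\<^sub>1) + 2 * \<rho> * C\<^sub>2)"
      using blocks Q k by (intro mult_left_mono) (auto simp: \<beta>_def)
    moreover have eq: "\<gamma> * n * Q * m = Q * h * (\<beta> * n * m)"
      unfolding k(3)[symmetric] by simp
    ultimately show ?thesis unfolding eq by (simp add: algebra_simps)
  qed
  have B: "\<gamma> * r * m \<le> 2 * Q * k * (d + \<rho> * C\<^sub>1) + 2 * Q * h * \<rho> * (C\<^sub>1 - T\<^sub>1)"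
  proof (cases "r = 0")
    case True
    then show ?thesis
      using Q k \<gamma> assms(5,8) C1 by simp
  next
    case False
    then have m: "m \<le> 2 * \<alpha> + 2 * (C\<^sub>1 - T\<^sub>1)" and en: "\<gamma> * (2 * R + 1) * \<alpha> \<le> 4 * (d + \<rho> * C\<^sub>1)"
      and RL: "6 * \<rho> \<le> (R + 4) * L"
      using first energy by (auto simp: \<gamma>_def)
    \<comment> \<open>At the cutoff the energy bound is so strong that its coefficient fits into the
      saved fraction \<open>k\<close>.\<close>
    have R: "4 / (2 * R + 1) \<le> k" "0 < 2 * R + 1"
    proof -
      have RL': "5 * \<rho> < (2 * R + 1) * L"
        using RL assms(4) by (simp add: algebra_simps)
      then show "0 < 2 * R + 1"
        using assms(3) \<gamma> by (smt (verit) mult_nonneg_nonneg mult_le_0_iff)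
      moreover have "4 * (2 * \<rho> - L) \<le> (2 * R + 1) * L"
        using RL assms(3,4) by (simp add: algebra_simps)
      ultimately show "4 / (2 * R + 1) \<le> k"
        using assms(3,4) by (simp add: k_def field_simps)
    qed
    have "\<gamma> * \<alpha> = (\<gamma> * (2 * R + 1) * \<alpha>) / (2 * R + 1)"
      using R by simp
    also have "\<dots> \<le> 4 * (d + \<rho> * C\<^sub>1) / (2 * R + 1)"
      using en R by (intro divide_right_mono) auto
    also have "\<dots> \<le> k * (d + \<rho> * C\<^sub>1)"
      using mult_right_mono[OF R(1), of "d + \<rho> * C\<^sub>1"] assms(5) C1 \<gamma> by simp
    finally have al: "\<gamma> * \<alpha> \<le> k * (d + \<rho> * C\<^sub>1)" .
    have "\<gamma> \<le> h * \<rho>"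
      using k \<gamma> assms(3) by (simp add: \<beta>_def mult_left_mono flip: k(3))
    then have "\<gamma> * (C\<^sub>1 - T\<^sub>1) \<le> h * \<rho> * (C\<^sub>1 - T\<^sub>1)"
      using assms(8) by (intro mult_right_mono) auto
    then have X: "\<gamma> * m \<le> 2 * k * (d + \<rho> * C\<^sub>1) + 2 * h * \<rho> * (C\<^sub>1 - T\<^sub>1)"
      using al mult_left_mono[OF m, of \<gamma>] \<gamma> by (simp add: algebra_simps)
    have "r * (\<gamma> * m) \<le> r * (2 * k * (d + \<rho> * C\<^sub>1) + 2 * h * \<rho> * (C\<^sub>1 - T\<^sub>1))"
      using X assms(1) by (rule mult_left_mono)
    also have "\<dots> \<le> Q * (2 * k * (d + \<rho> * C\<^sub>1) + 2 * h * \<rho> * (C\<^sub>1 - T\<^sub>1))"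
      using assms(2,5,8) k \<gamma> C1 by (intro mult_right_mono) auto
    finally show ?thesis by (simp add: algebra_simps)
  qed
  have "\<gamma> * ((n * Q + r) * m) \<le> 2 * Q * (d + \<rho> * (C\<^sub>1 + C\<^sub>2))"
  proof -
    have "0 \<le> Q * (k * (\<rho> * C\<^sub>2))" using Q k \<gamma> assms(6) by simp
    then show ?thesis
      using A B unfolding k(2) by (simp add: algebra_simps)
  qed
  then have "(n * Q + r) * m \<le> 2 * Q * (d + \<rho> * (C\<^sub>1 + C\<^sub>2)) / \<gamma>"
    using \<gamma> by (simp add: field_simps)
  then show ?thesis using C1 assms(6) by (simp add: \<gamma>_def)
qed

section \<open>The iteration\<close>

locale inexact_niAPG =
  fixes f :: "'a::euclidean_space \<Rightarrow> real" and g :: "'a \<Rightarrow> ereal"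
    and L \<eta> :: real and q :: nat
    and x v w :: "nat \<Rightarrow> 'a" and \<epsilon> :: "nat \<Rightarrow> real" and \<phi> :: "nat \<Rightarrow> nat" and B :: real
  assumes L: "0 < L" and \<eta>: "0 < \<eta>" "\<eta> < 1 / L"
    and diff: "\<And>u. f differentiable (at u)" and lip: "L-lipschitz_on UNIV (gradient f)"
    and g: "proper_fun g" "lsc_fun g" "convex_fun g"
    and lower: "\<And>u. ereal B \<le> objective f g u"
    and iter: "niAPG_inexact f g \<eta> q x v w \<epsilon>"
    and \<phi>: "\<And>k. 1 \<le> k \<Longrightarrow> is_arg_min (\<lambda>t. (norm (x (t + 1) - v t))\<^sup>2) (\<lambda>t. t \<in> window q k) (\<phi> k)"
begin

definition \<rho> :: real where "\<rho> = 1 / \<eta>"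
text \<open>Since \<open>real_of_ereal\<close> sends infinity to 0, this agrees with the objective
  only where \<open>g\<close> is finite; finiteness is tracked separately.\<close>

definition F :: "'a \<Rightarrow> real" where "F u = f u + real_of_ereal (g u)"
definition \<Phi> :: "nat \<Rightarrow> real" where "\<Phi> k = F (x k)"
definition a :: "nat \<Rightarrow> real" where "a k = (norm (x (k + 1) - v k))\<^sup>2"
definition b :: "nat \<Rightarrow> real" where "b k = (norm (prox_mapping \<eta> f g (v k)))\<^sup>2"
definition p :: "nat \<Rightarrow> 'a" where "p k = prox \<eta> g (forward_step \<eta> f (v k))"
text \<open>The gap minus the cross term gained by the step inequality at \<open>u = v k\<close>,
  clipped at 0.\<close>

definition \<tau> :: "nat \<Rightarrow> real" where
  "\<tau> k = max 0 (\<epsilon> k - max 0 ((x (k + 1) - p k) \<bullet> (v k - p k)))"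

lemma \<rho>_gt: "0 < \<rho>" "L < \<rho>"
  using L \<eta> by (simp_all add: \<rho>_def field_simps)

lemma objective_F: "g u \<noteq> \<infinity> \<Longrightarrow> objective f g u = ereal (F u)"
  using g(1) by (cases "g u") (auto simp: objective_def F_def proper_fun_def)

lemma objective_infinite: "g u = \<infinity> \<Longrightarrow> objective f g u = \<infinity>"
  by (simp add: objective_def)

lemma F_lower: "g u \<noteq> \<infinity> \<Longrightarrow> B \<le> F u"
  using lower[of u] by (simp add: objective_F)

lemma iter_step:
  assumes "1 \<le> k"
  shows "v k = (if objective f g (extrapolation x k) \<le> reference_value (objective f g) q x k
             then extrapolation x k else x k)"
    and "x (k + 1) = forward_step \<eta> f (v k) - \<eta> *\<^sub>R w k"
    and "ereal (\<epsilon> k) = prox_objective \<eta> g (forward_step \<eta> f (v k)) (x (k + 1))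
                    - dual_objective \<eta> g (forward_step \<eta> f (v k)) (w k)"
  using iter assms by (auto simp: niAPG_inexact_def)

lemmas prox_step = inexact_prox_step[OF diff lip g \<eta>(1) iter_step(2,3) p_def]

lemma g_iterate:
  assumes "2 \<le> k"
  shows "g (x k) \<noteq> \<infinity>"
proof -
  obtain i where "k = i + 1" "1 \<le> i"
    using assms by (intro that[of "k - 1"]) auto
  then show ?thesis
    using prox_step(1)[of i] by auto
qed

lemma step_ineq:
  assumes "1 \<le> k" "g u \<noteq> \<infinity>"
  shows "\<Phi> (Suc k) + \<rho> / 2 * (norm (x (Suc k) - u))\<^sup>2 + (\<rho> - L) / 2 * a k
      + max 0 (\<rho> * ((x (Suc k) - p k) \<bullet> (u - p k)))
    \<le> F u + (\<rho> + L) / 2 * (norm (v k - u))\<^sup>2 + \<rho> * \<epsilon> k"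
  using prox_step(3)[OF assms(1) assms(1,2)] by (simp add: \<Phi>_def F_def \<rho>_def a_def)

lemma \<epsilon>_nonneg: "1 \<le> k \<Longrightarrow> 0 \<le> \<epsilon> k"
  using prox_step(2)[of k] order_trans[OF zero_le_power2] by blast

lemma \<tau>_bounds: "0 \<le> \<tau> k" "1 \<le> k \<Longrightarrow> \<tau> k \<le> \<epsilon> k"
  using \<epsilon>_nonneg[of k] by (auto simp: \<tau>_def)

lemma b_le:
  assumes "1 \<le> k" "1 < s" "s \<le> 2"
  shows "b k \<le> s * a k + s / (s - 1) * (\<epsilon> k - \<tau> k)"
proof -
  have "b k = (norm (v k - p k))\<^sup>2"
    by (simp add: b_def prox_mapping_def p_def)
  also have "\<dots> \<le> s * (norm (v k - x (k + 1)))\<^sup>2 + s / (s - 1) * (\<epsilon> k - \<tau> k)"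
    unfolding \<tau>_def using assms(2,3) prox_step(2)[OF assms(1) assms(1)] by (intro norm_square_tradeoff) auto
  finally show ?thesis
    by (simp add: a_def norm_minus_commute)
qed

lemma \<phi>_window: "1 \<le> k \<Longrightarrow> \<phi> k \<in> window q k"
  and \<phi>_min: "i \<in> window q k \<Longrightarrow> a (\<phi> k) \<le> a i"
  using \<phi>[of k] by (auto simp: is_arg_min_linorder a_def window_def)

lemma v_le_reference:
  assumes "1 \<le> k"
  shows "objective f g (v k) \<le> reference_value (objective f g) q x k"
proof -
  have "objective f g (x k) \<le> reference_value (objective f g) q x k"
    unfolding reference_value_def using assms by (intro Max_ge) (auto simp: window_def)
  then show ?thesis
    using iter_step(1)[OF assms] by simp
qed

lemma reference_value_window_max:
  assumes "1 \<le> k" "\<And>t. t \<in> window q k \<Longrightarrow> g (x t) \<noteq> \<infinity>"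
  shows "reference_value (objective f g) q x k = ereal (window_max q \<Phi> k)"
proof -
  have "(\<lambda>t. objective f g (x t)) ` window q k = ereal ` \<Phi> ` window q k"
    using assms(2) by (simp add: image_image objective_F \<Phi>_def cong: image_cong)
  moreover have "ereal (Max (\<Phi> ` window q k)) = Max (ereal ` \<Phi> ` window q k)"
    using assms(1) by (intro mono_Max_commute) (auto simp: mono_def window_def)
  ultimately show ?thesis
    by (simp add: reference_value_def window_max_def)
qed

text \<open>The step inequality at \<open>u = v i\<close> adds \<open>\<rho> / 2\<close> and
  \<open>(\<rho> - L) / 2\<close> to the constant \<open>\<rho> - L / 2\<close>. A finite reference
  value forces \<open>g (v i)\<close> to be finite.\<close>

lemma descent_from:
  assumes "1 \<le> k0" and fin: "\<And>t. max 1 (k0 - q) \<le> t \<Longrightarrow> g (x t) \<noteq> \<infinity>"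
  shows "nonmonotone_descent \<Phi> a \<tau> (\<rho> - L / 2) \<rho> q k0 \<phi>"
proof
  show "\<Phi> (Suc i) \<le> window_max q \<Phi> i - (\<rho> - L / 2) * a i + \<rho> * \<tau> i" if "k0 \<le> i" for i
  proof -
    have i: "1 \<le> i" using assms(1) that by simp
    have "g (x t) \<noteq> \<infinity>" if "t \<in> window q i" for t
      using that \<open>k0 \<le> i\<close> by (intro fin) (auto simp: window_def)
    then have "objective f g (v i) \<le> ereal (window_max q \<Phi> i)"
      using v_le_reference[OF i] reference_value_window_max[OF i] by simp
    moreover from this have "g (v i) \<noteq> \<infinity>"
      using objective_infinite by fastforce
    ultimately have v: "g (v i) \<noteq> \<infinity>" "F (v i) \<le> window_max q \<Phi> i"
      by (simp_all add: objective_F)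
    define T where "T = (x (Suc i) - p i) \<bullet> (v i - p i)"
    have "max 0 (\<rho> * T) = \<rho> * max 0 T"
      using \<rho>_gt(1) by (simp add: max_mult_distrib_left)
    moreover have "\<rho> * (\<epsilon> i - max 0 T) \<le> \<rho> * \<tau> i"
      using \<rho>_gt(1) by (intro mult_left_mono) (auto simp: \<tau>_def T_def)
    moreover have "\<Phi> (Suc i) + \<rho> / 2 * a i + (\<rho> - L) / 2 * a i + max 0 (\<rho> * T) \<le> F (v i) + \<rho> * \<epsilon> i"
      using step_ineq[OF i v(1)] by (simp add: a_def T_def)
    ultimately show ?thesis
      using v(2) by (simp add: field_simps)
  qed
qed (use assms(1) \<rho>_gt L \<phi>_window \<phi>_min \<tau>_bounds in \<open>auto simp: a_def\<close>)

text \<open>\<open>F (x 1)\<close> may be infinite; from index \<open>q + 2\<close> on it has left all windows.\<close>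

lemma prox_mapping_tendsto_zero:
  assumes "summable (\<lambda>k. \<epsilon> (k + 1))"
  shows "(\<lambda>k. b (\<phi> k)) \<longlonglongrightarrow> 0"
proof -
  interpret nonmonotone_descent \<Phi> a \<tau> "\<rho> - L / 2" \<rho> q "q + 2" \<phi>
  proof (rule descent_from)
    show "g (x t) \<noteq> \<infinity>" if "max 1 (q + 2 - q) \<le> t" for t
      using that by (intro g_iterate) simp
  qed simp
  \<comment> \<open>The shift is needed because \<epsilon> bounds \<tau> only from index 1
    on.\<close>
  have "summable (\<lambda>k. \<tau> (k + 1))"
    using \<tau>_bounds by (intro summable_comparison_test'[OF assms]) auto
  then have "summable \<tau>"
    using summable_iff_shift[of \<tau> 1] by simp
  moreover have "B \<le> \<Phi> i" if "q + 2 \<le> i" for i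
    unfolding \<Phi>_def using that by (intro F_lower g_iterate) simp
  ultimately have a0: "(\<lambda>k. a (\<phi> k)) \<longlonglongrightarrow> 0"
    by (rule selected_tendsto_zero)
  have "(\<lambda>k. \<epsilon> (k + 1)) \<longlonglongrightarrow> 0"
    using assms by (rule summable_LIMSEQ_zero)
  then have \<epsilon>0: "\<epsilon> \<longlonglongrightarrow> 0"
    by (rule LIMSEQ_offset)
  \<comment> \<open>A selected index lags behind by at most \<open>q\<close>, so the gaps along it
    vanish too.\<close>
  have "filterlim \<phi> sequentially sequentially"
    unfolding filterlim_at_top
  proof
    fix Z
    show "\<forall>\<^sub>F k in sequentially. Z \<le> \<phi> k"
      using eventually_ge_at_top[of "Z + q + 1"]
    proof eventually_elim
      case (elim k)
      then show ?case using \<phi>_window[of k] by (auto simp: window_def)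
    qed
  qed
  then have e0: "(\<lambda>k. \<epsilon> (\<phi> k)) \<longlonglongrightarrow> 0"
    by (rule filterlim_compose[OF \<epsilon>0])
  show ?thesis
  proof (rule tendsto_sandwich[where f = "\<lambda>_. 0" and h = "\<lambda>k. 2 * a (\<phi> k) + 2 * \<epsilon> (\<phi> k)"])
    show "\<forall>\<^sub>F k in sequentially. b (\<phi> k) \<le> 2 * a (\<phi> k) + 2 * \<epsilon> (\<phi> k)"
      using eventually_ge_at_top[of 1]
    proof eventually_elim
      case (elim k)
      then have "1 \<le> \<phi> k" using \<phi>_window[of k] by (auto simp: window_def)
      then show ?case using b_le[of "\<phi> k" 2] \<tau>_bounds(1)[of "\<phi> k"] by simp
    qed
    show "(\<lambda>k. 2 * a (\<phi> k) + 2 * \<epsilon> (\<phi> k)) \<longlonglongrightarrow> 0"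
      using tendsto_add[OF tendsto_mult[OF tendsto_const a0, of 2] tendsto_mult[OF tendsto_const e0, of 2]] by simp
  qed (auto simp: b_def)
qed

section \<open>The rate over the first \<open>K\<close> steps\<close>

lemma early_energy:
  assumes fin: "g (x 1) \<noteq> \<infinity>" and "1 \<le> R" "real (R + 3) * L \<le> 6 * \<rho>"
    and \<alpha>: "\<And>j. j \<in> {1..R} \<Longrightarrow> \<alpha> \<le> a j"
  shows "(\<rho> - L) * (2 * real R + 1) * \<alpha> \<le> 4 * (\<Phi> 1 - B + \<rho> * sum \<epsilon> {1..R})"
proof -
  define \<theta> where "\<theta> i = (real i - 1) / (real i + 2)" for i
  define D where "D i = (norm (x i - x (i - 1)))\<^sup>2" for i
  have gx: "g (x i) \<noteq> \<infinity>" if "1 \<le> i" for i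
    using fin g_iterate[of i] that by (cases "i = 1") auto
  \<comment> \<open>Equal starting points make the first extrapolation trivial, whence
    \<open>D 2 = a 1\<close>.\<close>
  have "x (Suc 0) = x 0"
    using iter by (simp add: niAPG_inexact_def)
  then have v1: "v 1 = x 1"
    using iter_step(1)[of 1] by (simp add: extrapolation_def)
  have vx: "(norm (v i - x i))\<^sup>2 \<le> (\<theta> i)\<^sup>2 * D i" if "1 \<le> i" for i
    using iter_step(1)[OF that] by (auto simp: extrapolation_def \<theta>_def D_def power_mult_distrib power_divide)
  have "\<Phi> (Suc R) + (\<rho> + L) / 2 * ((\<theta> (Suc R))\<^sup>2 * D (Suc R)) + (\<rho> - L) / 2 * (sum a {1..R} + a 1 / 2)
      \<le> \<Phi> 1 + \<rho> * sum \<epsilon> {1..R}"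
  proof (rule momentum_energy)
    show "\<Phi> (Suc i) + \<rho> / 2 * D (Suc i) + (\<rho> - L) / 2 * a i
        \<le> \<Phi> i + (\<rho> + L) / 2 * ((\<theta> i)\<^sup>2 * D i) + \<rho> * \<epsilon> i" if "1 \<le> i" for i
    proof -
      have "(\<rho> + L) / 2 * (norm (v i - x i))\<^sup>2 \<le> (\<rho> + L) / 2 * ((\<theta> i)\<^sup>2 * D i)"
        using vx[OF that] \<rho>_gt L by (intro mult_left_mono) auto
      then show ?thesis
        using step_ineq[OF that gx[OF that]] by (simp add: D_def \<Phi>_def)
    qed
    show "D 2 = a 1"
      using v1 by (simp add: D_def a_def numeral_2_eq_2)
  qed (use L \<rho>_gt assms in \<open>auto simp: D_def \<theta>_def\<close>)
  moreover have "0 \<le> (\<rho> + L) / 2 * ((\<theta> (Suc R))\<^sup>2 * D (Suc R))"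
    using \<rho>_gt L by (simp add: D_def)
  moreover have "B \<le> \<Phi> (Suc R)"
    unfolding \<Phi>_def by (intro F_lower gx) simp
  moreover have "(\<rho> - L) / 2 * (real R * \<alpha> + \<alpha> / 2) \<le> (\<rho> - L) / 2 * (sum a {1..R} + a 1 / 2)"
  proof -
    have "real R * \<alpha> \<le> sum a {1..R}"
      using sum_bounded_below[of "{1..R}" \<alpha> a] \<alpha> by simp
    moreover have "\<alpha> \<le> a 1" using \<alpha> assms(2) by simp
    ultimately show ?thesis
      using \<rho>_gt by (intro mult_left_mono) auto
  qed
  ultimately show ?thesis
    by (simp add: field_simps)
qed

text \<open>The windows ending at \<open>r + j * (q + 1)\<close> for \<open>j\<close> from 1 to
  \<open>n\<close> partition the indices after \<open>r\<close>, and the window at \<open>r\<close>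
  is exactly the initial stretch. One lower bound \<open>m\<close> is thus tested against all blocks
  and against the stretch.\<close>

lemma rate:
  assumes fin: "g (x 1) \<noteq> \<infinity>" and m: "\<And>k. k \<in> {1..K} \<Longrightarrow> m \<le> b (\<phi> k)"
  shows "real K * m \<le> 8 * sum \<epsilon> {1..K} + 2 * real (q + 1) * (\<Phi> 1 - B + \<rho> * sum \<epsilon> {1..K}) / (\<rho> - L)"
proof -
  have gx: "g (x i) \<noteq> \<infinity>" if "1 \<le> i" for i
    using fin g_iterate[of i] that by (cases "i = 1") auto
  interpret nonmonotone_descent \<Phi> a \<tau> "\<rho> - L / 2" \<rho> q 1 \<phi>
    by (rule descent_from) (simp_all add: gx)
  define r n where "r = K mod (q + 1)" and "n = K div (q + 1)"
  have K: "K = r + n * Suc q"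
    unfolding r_def n_def Suc_eq_plus1 by (rule mod_div_mult_eq[symmetric])
  have rq: "r \<le> q"
    by (simp add: r_def less_Suc_eq_le[symmetric])
  define C1 C2 T1 d where "C1 = sum \<epsilon> {1..r}" and "C2 = sum \<epsilon> {Suc r..K}" and "T1 = sum \<tau> {1..r}"
    and "d = \<Phi> 1 - B"
  have C: "sum \<epsilon> {1..K} = C1 + C2"
    using sum.ub_add_nat[of 1 r \<epsilon> "n * Suc q"] unfolding C1_def C2_def K by simp
  have signs: "0 \<le> d" "0 \<le> C2" "0 \<le> T1" "T1 \<le> C1"
    unfolding d_def C2_def T1_def C1_def \<Phi>_def
    using F_lower[OF fin] \<epsilon>_nonneg \<tau>_bounds by (auto intro!: sum_nonneg sum_mono)
  have \<phi>1: "1 \<le> \<phi> k" if "1 \<le> k" for k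
    using \<phi>_window[OF that] by (simp add: window_def)
  have blocks: "(\<rho> - L / 2) * real n * m
      \<le> s * (d + \<rho> * T1) + max (s * \<rho>) (s / (s - 1) * (\<rho> - L / 2)) * C2" if s: "1 < s" "s \<le> 2" for s
  proof -
    have "(\<rho> - L / 2) * real n * m + s * window_max q \<Phi> (Suc (r + n * Suc q))
      \<le> s * window_max q \<Phi> (Suc r) + max (s * \<rho>) (s / (s - 1) * (\<rho> - L / 2)) * sum \<epsilon> {Suc r..r + n * Suc q}"
    proof (rule block_sum)
      fix j assume "j < n"
      define k where "k = r + Suc j * Suc q"
      have "Suc j * Suc q \<le> n * Suc q" using \<open>j < n\<close> by (intro mult_le_mono1) simp
      then have k: "k \<in> {1..K}"
        by (auto simp: k_def K)
      then show "m \<le> s * a (\<phi> k) + s / (s - 1) * (\<epsilon> (\<phi> k) - \<tau> (\<phi> k))"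
        using m[OF k] b_le[OF \<phi>1 s, of k] by simp
    qed (use s \<tau>_bounds in auto)
    moreover have "s * B \<le> s * window_max q \<Phi> (Suc K)"
    proof -
      have "B \<le> \<Phi> (Suc K)"
        unfolding \<Phi>_def by (intro F_lower gx) simp
      also have "\<dots> \<le> window_max q \<Phi> (Suc K)"
        by (rule window_max_ge) (simp add: window_def)
      finally show ?thesis using s by simp
    qed
    moreover have "s * window_max q \<Phi> (Suc r) \<le> s * (\<Phi> 1 + \<rho> * T1)"
    proof -
      have "window_max q \<Phi> 1 = \<Phi> 1"
        by (simp add: window_max_def window_def)
      then show ?thesis
        using window_max_le[of 1 "Suc r"] s by (simp add: T1_def atLeastLessThanSuc_atLeastAtMost)
    qed
    ultimately show ?thesis
      by (simp add: d_def C2_def K algebra_simps)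
  qed
  have window_r: "window q r = {1..r}"
    using rq by (simp add: window_def)
  have first: "m \<le> s * a (\<phi> r) + s / (s - 1) * (C1 - T1)" if r: "1 \<le> r" and s: "1 < s" "s \<le> 2" for s
  proof -
    have "\<epsilon> (\<phi> r) - \<tau> (\<phi> r) \<le> (\<Sum>i\<in>{1..r}. \<epsilon> i - \<tau> i)"
      using \<phi>_window[OF r] \<tau>_bounds by (intro member_le_sum) (auto simp: window_r)
    then have "s / (s - 1) * (\<epsilon> (\<phi> r) - \<tau> (\<phi> r)) \<le> s / (s - 1) * (C1 - T1)"
      using s by (intro mult_left_mono) (auto simp: C1_def T1_def sum_subtractf)
    moreover have "m \<le> b (\<phi> r)"
      using m[of r] r by (simp add: K)
    ultimately show ?thesis
      using b_le[OF \<phi>1[OF r] s] by linarith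
  qed
  have energy: "(\<rho> - L) * (2 * real R + 1) * a (\<phi> r) \<le> 4 * (d + \<rho> * C1)"
    if R: "1 \<le> R" "R \<le> r" "real (R + 3) * L \<le> 6 * \<rho>" for R
  proof -
    have "(\<rho> - L) * (2 * real R + 1) * a (\<phi> r) \<le> 4 * (\<Phi> 1 - B + \<rho> * sum \<epsilon> {1..R})"
      using R by (intro early_energy[OF fin]) (auto intro!: \<phi>_min simp: window_r)
    also have "\<rho> * sum \<epsilon> {1..R} \<le> \<rho> * C1"
      unfolding C1_def using R \<epsilon>_nonneg \<rho>_gt by (intro mult_left_mono sum_mono2) auto
    finally show ?thesis by (simp add: d_def)
  qed
  have "(real n * real (q + 1) + real r) * m
      \<le> 8 * (C1 + C2) + 2 * real (q + 1) * (d + \<rho> * (C1 + C2)) / (\<rho> - L)"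
  proof (cases "1 \<le> r \<and> real (r + 3) * L \<le> 6 * \<rho>")
    case True
    have r: "1 \<le> r" "real (r + 3) * L \<le> 6 * \<rho>"
      using True by auto
    show ?thesis
    proof (rule rate_arithmetic_early[OF _ _ L \<rho>_gt(2) signs(1,2,3,4) blocks first[OF r(1)] energy[OF r(1) _ r(2)]])
      show "1 \<le> real r" "real r + 1 \<le> real (q + 1)" "r \<le> r"
        using r(1) rq by auto
    qed
  next
    case False
    \<comment> \<open>\<open>R\<close> is the largest index at which the energy estimate is
      available; as \<open>\<rho>\<close> exceeds \<open>L\<close>, \<open>N\<close> is at least 6
      and the subtraction is not truncated.\<close>
    define N where "N = nat \<lfloor>6 * \<rho> / L\<rfloor>"
    define R where "R = N - 3"
    have "6 < 6 * \<rho> / L"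
      using L \<rho>_gt by (simp add: field_simps)
    then have floor: "6 \<le> \<lfloor>6 * \<rho> / L\<rfloor>" by linarith
    then have N: "int N = \<lfloor>6 * \<rho> / L\<rfloor>"
      unfolding N_def by (intro nat_0_le) linarith
    with floor have "6 \<le> N" by linarith
    then have R: "1 \<le> R" "real R + 3 = real_of_int \<lfloor>6 * \<rho> / L\<rfloor>"
      unfolding N[symmetric] by (simp_all add: R_def of_nat_diff)
    then have "real R + 3 \<le> 6 * \<rho> / L" "6 * \<rho> / L \<le> real R + 4"
      by linarith+
    then have RL: "real (R + 3) * L \<le> 6 * \<rho>" "6 * \<rho> \<le> (real R + 4) * L"
      using L by (simp_all add: field_simps)
    \<comment> \<open>For nonzero \<open>r\<close> the early case can only have failed because
      \<open>r\<close> lies beyond the cutoff.\<close>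
    have "R \<le> r" if "r \<noteq> 0"
    proof (rule ccontr)
      assume "\<not> R \<le> r"
      then have "real (r + 3) * L \<le> real (R + 3) * L"
        using L by (intro mult_right_mono) auto
      with RL(1) False that show False by auto
    qed
    then have "r = 0 \<or> (\<rho> - L) * (2 * real R + 1) * a (\<phi> r) \<le> 4 * (d + \<rho> * C1) \<and> 6 * \<rho> \<le> (real R + 4) * L"
      using energy[OF R(1) _ RL(1)] RL(2) by blast
    moreover have "r = 0 \<or> m \<le> 2 * a (\<phi> r) + 2 * (C1 - T1)"
      using first[of 2] by (cases "1 \<le> r") auto
    moreover have "(\<rho> - L / 2) * real n * m \<le> 2 * (d + \<rho> * T1) + 2 * \<rho> * C2"
      using blocks[of 2] L by (simp add: max_def split: if_splits)
    ultimately show ?thesis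
      using rq
      by (intro rate_arithmetic_late[OF _ _ L \<rho>_gt(2) signs]) auto
  qed
  then show ?thesis
    unfolding C d_def by (simp add: K algebra_simps)
qed

end

theorem proposition4p6:
  fixes f :: "real ^ 'd \<Rightarrow> real" and g :: "real ^ 'd \<Rightarrow> ereal"
    and L \<eta> \<delta> \<rho> \<sigma> c :: real and q :: nat and c\<^sub>1 :: ereal
    and x v w :: "nat \<Rightarrow> real ^ 'd" and \<epsilon> :: "nat \<Rightarrow> real" and \<phi> :: "nat \<Rightarrow> nat"
  defines "\<rho> \<equiv> 1 / \<eta>"
    and "c \<equiv> (\<Sum>k. \<epsilon> (k + 1))"
    and "c\<^sub>1 \<equiv> Max ((\<lambda>t. objective f g (x t)) ` {1..q + 1}) - (INF u. objective f g u)"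
  assumes "L > 0"
    and "\<And>u. f differentiable (at u)"
    and "L-lipschitz_on UNIV (gradient f)"
    and "proper_fun g" and "lsc_fun g" and "convex_fun g"
    and "\<exists>B::real. \<forall>u. ereal B \<le> objective f g u"
    and "(objective f g \<longlongrightarrow> \<infinity>) at_infinity"
    and "0 < \<eta>" and "\<eta> < 1 / L"
    and "0 < \<delta>" and "\<delta> < 1 / \<eta> - L"
    and "niAPG_inexact f g \<eta> q x v w \<epsilon>"
    and "\<sigma> > 0" and "\<epsilon> \<in> O(\<lambda>k. 1 / real k powr (1 + \<sigma>))"
    and "\<And>k. k \<ge> 1 \<Longrightarrow> is_arg_min (\<lambda>t. (norm (x (t + 1) - v t))\<^sup>2) (\<lambda>t. t \<in> window q k) (\<phi> k)"
  shows "summable (\<lambda>k. \<epsilon> (k + 1))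
    \<and> ((\<lambda>k. (norm (prox_mapping \<eta> f g (v (\<phi> k))))\<^sup>2) \<longlonglongrightarrow> 0)
    \<and> (\<forall>K\<ge>1. ereal (Min ((\<lambda>k. (norm (prox_mapping \<eta> f g (v (\<phi> k))))\<^sup>2) ` {1..K}))
          \<le> ereal (2 / real K)
             * (ereal (4 * c) + ereal (real (q + 1)) * (c\<^sub>1 + ereal (\<rho> * c)) / ereal (\<rho> - L)))"
proof -
  define I where "I = real_of_ereal (INF u. objective f g u)"
  \<comment> \<open>The infimum is real: the objective is bounded below, and properness of
    \<open>g\<close> gives a finite value.\<close>
  have I: "(INF u. objective f g u) = ereal I"
  proof -
    obtain B :: real where "\<And>u. ereal B \<le> objective f g u"
      using assms(10) by blast
    then have "ereal B \<le> (INF u. objective f g u)"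
      by (intro INF_greatest) simp
    moreover obtain u where "g u \<noteq> \<infinity>"
      using assms(7) by (auto simp: proper_fun_def)
    then have "objective f g u \<noteq> \<infinity>"
      by (simp add: objective_def)
    moreover have "(INF u. objective f g u) \<le> objective f g u"
      by (rule INF_lower) simp
    ultimately have "\<bar>INF u. objective f g u\<bar> \<noteq> \<infinity>"
      by (cases "INF u. objective f g u") auto
    then show ?thesis
      by (simp add: I_def ereal_real')
  qed
  interpret S: inexact_niAPG f g L \<eta> q x v w \<epsilon> \<phi> I
  proof
    show "ereal I \<le> objective f g u" for u
      unfolding I[symmetric] by (rule INF_lower) simp
  qed (use assms in auto)
  have \<rho>: "\<rho> = S.\<rho>" by (simp add: \<rho>_def S.\<rho>_def)
  have pos: "0 < \<rho>" "L < \<rho>" using S.\<rho>_gt by (simp_all add: \<rho>)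
  have "summable (\<lambda>k. 1 / real k powr (1 + \<sigma>))"
    using summable_real_powr_iff[of "- (1 + \<sigma>)"] \<open>\<sigma> > 0\<close> unfolding powr_minus_divide by simp
  then have "summable \<epsilon>"
    by (intro summable_comparison_test_bigo[OF _ assms(18)]) simp
  then have sum: "summable (\<lambda>k. \<epsilon> (k + 1))"
    using summable_iff_shift[of \<epsilon> 1] by simp
  have part: "sum \<epsilon> {1..K} \<le> c" for K
  proof -
    have "sum \<epsilon> {1..K} = (\<Sum>k<K. \<epsilon> (k + 1))"
      by (simp add: sum.atLeast1_atMost_eq)
    also have "\<dots> \<le> c"
      unfolding c_def using sum S.\<epsilon>_nonneg by (intro sum_le_suminf) auto
    finally show ?thesis .
  qed
  have bound: "ereal (Min ((\<lambda>k. (norm (prox_mapping \<eta> f g (v (\<phi> k))))\<^sup>2) ` {1..K}))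
          \<le> ereal (2 / real K)
             * (ereal (4 * c) + ereal (real (q + 1)) * (c\<^sub>1 + ereal (\<rho> * c)) / ereal (\<rho> - L))" if "K \<ge> 1" for K
  proof -
    define m where "m = Min ((\<lambda>k. S.b (\<phi> k)) ` {1..K})"
    define M where "M = Max ((\<lambda>t. objective f g (x t)) ` {1..q + 1})"
    have M1: "objective f g (x 1) \<le> M"
      unfolding M_def by (intro Max_ge) auto
    \<comment> \<open>An infinite initial gap makes the right side infinite; otherwise the first
      iterate has a finite value and the real-valued rate applies.\<close>
    show ?thesis
    proof (cases "c\<^sub>1 = \<infinity>")
      case True
      then show ?thesis using that pos by simp
    next
      case False
      then have "M \<noteq> \<infinity>"
        by (auto simp: c\<^sub>1_def M_def I)
      then have fin: "g (x 1) \<noteq> \<infinity>"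
        using M1 S.objective_infinite by fastforce
      then have "ereal (S.\<Phi> 1) \<le> M"
        using M1 by (simp add: S.objective_F S.\<Phi>_def)
      with \<open>M \<noteq> \<infinity>\<close> obtain M' where M': "M = ereal M'" "S.\<Phi> 1 \<le> M'"
        by (cases M) auto
      then have c1: "c\<^sub>1 = ereal (M' - I)"
        unfolding c\<^sub>1_def M_def[symmetric] I M'(1) by simp
      have "m \<le> S.b (\<phi> k)" if "k \<in> {1..K}" for k
        unfolding m_def using that by (intro Min_le) auto
      then have "real K * m \<le> 8 * sum \<epsilon> {1..K} + 2 * real (q + 1) * (S.\<Phi> 1 - I + \<rho> * sum \<epsilon> {1..K}) / (\<rho> - L)"
        unfolding \<rho> by (rule S.rate[OF fin])
      \<comment> \<open>The initial value is at most the maximum in \<open>c\<^sub>1\<close>, and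
        partial sums of the nonnegative gaps are at most \<open>c\<close>.\<close>
      also have "\<dots> \<le> 8 * c + 2 * real (q + 1) * (M' - I + \<rho> * c) / (\<rho> - L)"
        using part[of K] M' pos by (intro add_mono divide_right_mono mult_left_mono diff_mono) auto
      also have "\<dots> = real K * (2 / real K * (4 * c + real (q + 1) * (M' - I + \<rho> * c) / (\<rho> - L)))"
        using that by (simp add: field_simps)
      finally have "m \<le> 2 / real K * (4 * c + real (q + 1) * (M' - I + \<rho> * c) / (\<rho> - L))"
        by (rule mult_left_le_imp_le) (use that in simp)
      then show ?thesis
        using pos by (simp add: c1 m_def S.b_def)
    qed
  qed
  show ?thesis
    using sum S.prox_mapping_tendsto_zero[OF sum] bound unfolding S.b_def by blast
qed

end
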